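(* Let $H$ be a Hilbert $\mathfrak{A}$-module over a $C^*$-algebra $\mathfrak{A}$. Suppose that $T,A,S,B\in\mathcal{L}(H)$ are such that $T$ and $S$ have the polar decompositions $T=U_T|T|$ and $S=U_S|S|$, and $B$ is a contraction (i.e. $\|B\|\le 1$). Let $X=TAS$, $Y=|T|\cdot A\cdot|S^*|$ and $W=U_T^*U_TBU_SU_S^*$. Then the following statements are equivalent: (i) $X=U_TBU_S|X|$ is the polar decomposition; (ii) $Y=W|Y|$ is the polar decomposition; (iii) $B^*Y\ge 0$, $BB^*Y=Y$ and $\overline{\mathcal{R}(W)}=\overline{\mathcal{R}(Y)}$; (iv) $B^*Y\ge 0$, $BB^*Y=Y$ and $\overline{\mathcal{R}(W^* )}=\overline{\mathcal{R}(Y^* )}$.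
   Context: $\mathcal{L}(H)$ denotes the $C^*$-algebra of adjointable operators on $H$; $\mathcal{R}(\cdot)$ denotes range; $B\ge 0$ means that $B$ is a positive element of $\mathcal{L}(H)$. For an adjointable operator $B$, $|B|=(B^*B)^{1/2}$. A closed submodule $M$ of $H$ is orthogonally complemented if $H=M\dotplus M^\perp$, and then $P_M$ is the projection of $H$ onto $M$. An operator $U\in\mathcal{L}(H)$ is a partial isometry if $U^*U$ is a projection. Polar decomposition: for $B\in\mathcal{L}(H)$, "$B=U|B|$ is the polar decomposition" (or "$B$ has the polar decomposition $B=U|B|$") means that $U\in\mathcal{L}(H)$ is a partial isometry such that $B=U|B|$ and $U^*U=P_{\overline{\mathcal{R}(B^* )}}$ (in particular $\overline{\mathcal{R}(B^* )}$ is orthogonally complemented). Such a $U$ is unique if it exists, but it need not exist in general. *)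

theory Defs
  imports "HOL-Analysis.Analysis"
begin

section \<open>Complex Banach spaces and C*-algebras\<close>

class complex_banach = banach +
  fixes scaleC :: "complex \<Rightarrow> 'a \<Rightarrow> 'a" (infixr "*\<^sub>C" 75)
  assumes scaleC_add_right: "c *\<^sub>C (x + y) = c *\<^sub>C x + c *\<^sub>C y"
    and scaleC_add_left: "(c + d) *\<^sub>C x = c *\<^sub>C x + d *\<^sub>C x"
    and scaleC_scaleC: "c *\<^sub>C (d *\<^sub>C x) = (c * d) *\<^sub>C x"
    and scaleR_scaleC: "r *\<^sub>R x = complex_of_real r *\<^sub>C x"
    and norm_scaleC: "norm (c *\<^sub>C x) = cmod c * norm x"

text \<open>No unit is assumed.\<close>

class cstar_algebra = complex_banach + real_normed_algebra +
  fixes star :: "'a \<Rightarrow> 'a"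
  assumes mult_scaleC_left: "(c *\<^sub>C a) * b = c *\<^sub>C (a * b)"
    and mult_scaleC_right: "a * (c *\<^sub>C b) = c *\<^sub>C (a * b)"
    and star_star: "star (star a) = a"
    and star_add: "star (a + b) = star a + star b"
    and star_scaleC: "star (c *\<^sub>C a) = cnj c *\<^sub>C star a"
    and star_mult: "star (a * b) = star b * star a"
    and cstar_identity: "norm (star a * a) = (norm a)\<^sup>2"

text \<open>
  As the algebra need not have a unit, spectra are taken in its unitization, whose elements
  are the pairs \<open>(a, \<alpha>)\<close> standing for \<open>a + \<alpha> 1\<close>.  Therefore \<open>0\<close> always belongs to the
  spectrum, also if the algebra is unital; this has no influence on positivity.
\<close>

definition unitization_mult ::
    "'a::cstar_algebra \<times> complex \<Rightarrow> 'a \<times> complex \<Rightarrow> 'a \<times> complex" where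
  "unitization_mult u v =
     (fst u * fst v + snd u *\<^sub>C fst v + snd v *\<^sub>C fst u, snd u * snd v)"

definition cstar_spectrum :: "'a::cstar_algebra \<Rightarrow> complex set" where
  "cstar_spectrum a =
     {z. \<not> (\<exists>u. unitization_mult (a, - z) u = (0, 1) \<and> unitization_mult u (a, - z) = (0, 1))}"

definition cstar_positive :: "'a::cstar_algebra \<Rightarrow> bool" where
  "cstar_positive a \<longleftrightarrow> star a = a \<and> cstar_spectrum a \<subseteq> \<real>\<^sub>\<ge>\<^sub>0"


section \<open>Hilbert modules\<close>

text \<open>
  Right modules, with inner products linear in the second argument.  The norm of the Banach
  space is required to be the one induced by the inner product, so completeness of the
  module is part of the type class.
\<close>

locale hilbert_module =
  fixes act :: "'h::complex_banach \<Rightarrow> 'a::cstar_algebra \<Rightarrow> 'h"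
    and ip :: "'h \<Rightarrow> 'h \<Rightarrow> 'a"
  assumes act_add_left: "act (x + y) a = act x a + act y a"
    and act_add_right: "act x (a + b) = act x a + act x b"
    and act_mult: "act x (a * b) = act (act x a) b"
    and act_scaleC_left: "act (c *\<^sub>C x) a = c *\<^sub>C act x a"
    and act_scaleC_right: "act x (c *\<^sub>C a) = c *\<^sub>C act x a"
    and ip_add_right: "ip x (y + z) = ip x y + ip x z"
    and ip_scaleC_right: "ip x (c *\<^sub>C y) = c *\<^sub>C ip x y"
    and ip_act_right: "ip x (act y a) = ip x y * a"
    and ip_star: "star (ip x y) = ip y x"
    and ip_positive: "cstar_positive (ip x x)"
    and ip_definite: "ip x x = 0 \<Longrightarrow> x = 0"
    and norm_ip: "norm x = sqrt (norm (ip x x))"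


section \<open>The C*-algebra of adjointable operators\<close>

text \<open>The inner product of the module is an explicit first argument from here on.\<close>

definition adjointable ::
    "('h::complex_banach \<Rightarrow> 'h \<Rightarrow> 'a::cstar_algebra) \<Rightarrow> ('h \<Rightarrow> 'h) \<Rightarrow> bool" where
  "adjointable ip T \<longleftrightarrow> (\<exists>R. \<forall>x y. ip (T x) y = ip x (R y))"

definition adj ::
    "('h::complex_banach \<Rightarrow> 'h \<Rightarrow> 'a::cstar_algebra) \<Rightarrow> ('h \<Rightarrow> 'h) \<Rightarrow> 'h \<Rightarrow> 'h" where
  "adj ip T = (THE R. \<forall>x y. ip (T x) y = ip x (R y))"

definition op_spectrum ::
    "('h::complex_banach \<Rightarrow> 'h \<Rightarrow> 'a::cstar_algebra) \<Rightarrow> ('h \<Rightarrow> 'h) \<Rightarrow> complex set" where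
  "op_spectrum ip T =
     {z. \<not> (\<exists>R. adjointable ip R \<and>
               (\<lambda>x. T x - z *\<^sub>C x) \<circ> R = id \<and> R \<circ> (\<lambda>x. T x - z *\<^sub>C x) = id)}"

definition op_positive ::
    "('h::complex_banach \<Rightarrow> 'h \<Rightarrow> 'a::cstar_algebra) \<Rightarrow> ('h \<Rightarrow> 'h) \<Rightarrow> bool" where
  "op_positive ip T \<longleftrightarrow> adjointable ip T \<and> adj ip T = T \<and> op_spectrum ip T \<subseteq> \<real>\<^sub>\<ge>\<^sub>0"

definition op_sqrt ::
    "('h::complex_banach \<Rightarrow> 'h \<Rightarrow> 'a::cstar_algebra) \<Rightarrow> ('h \<Rightarrow> 'h) \<Rightarrow> 'h \<Rightarrow> 'h" where
  "op_sqrt ip T = (THE R. op_positive ip R \<and> R \<circ> R = T)"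

definition op_abs ::
    "('h::complex_banach \<Rightarrow> 'h \<Rightarrow> 'a::cstar_algebra) \<Rightarrow> ('h \<Rightarrow> 'h) \<Rightarrow> 'h \<Rightarrow> 'h" where
  "op_abs ip T = op_sqrt ip (adj ip T \<circ> T)"


section \<open>Polar decompositions\<close>

definition orth_compl ::
    "('h::complex_banach \<Rightarrow> 'h \<Rightarrow> 'a::cstar_algebra) \<Rightarrow> 'h set \<Rightarrow> 'h set" where
  "orth_compl ip M = {x. \<forall>y\<in>M. ip x y = 0}"

definition orthogonally_complemented ::
    "('h::complex_banach \<Rightarrow> 'h \<Rightarrow> 'a::cstar_algebra) \<Rightarrow> 'h set \<Rightarrow> bool" where
  "orthogonally_complemented ip M \<longleftrightarrow>
     (\<forall>x. \<exists>m\<in>M. \<exists>n\<in>orth_compl ip M. x = m + n) \<and> M \<inter> orth_compl ip M = {0}"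

text \<open>Meaningful only if \<open>M\<close> is an orthogonally complemented closed submodule.\<close>

definition proj_onto ::
    "('h::complex_banach \<Rightarrow> 'h \<Rightarrow> 'a::cstar_algebra) \<Rightarrow> 'h set \<Rightarrow> 'h \<Rightarrow> 'h" where
  "proj_onto ip M x = (THE m. m \<in> M \<and> x - m \<in> orth_compl ip M)"

definition op_projection ::
    "('h::complex_banach \<Rightarrow> 'h \<Rightarrow> 'a::cstar_algebra) \<Rightarrow> ('h \<Rightarrow> 'h) \<Rightarrow> bool" where
  "op_projection ip P \<longleftrightarrow> adjointable ip P \<and> adj ip P = P \<and> P \<circ> P = P"

definition partial_isometry ::
    "('h::complex_banach \<Rightarrow> 'h \<Rightarrow> 'a::cstar_algebra) \<Rightarrow> ('h \<Rightarrow> 'h) \<Rightarrow> bool" where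
  "partial_isometry ip U \<longleftrightarrow> adjointable ip U \<and> op_projection ip (adj ip U \<circ> U)"

text \<open>\<open>polar_decomposition ip B U\<close>: \<open>B = U |B|\<close> is the polar decomposition of \<open>B\<close>.\<close>

definition polar_decomposition ::
    "('h::complex_banach \<Rightarrow> 'h \<Rightarrow> 'a::cstar_algebra) \<Rightarrow> ('h \<Rightarrow> 'h) \<Rightarrow> ('h \<Rightarrow> 'h) \<Rightarrow> bool" where
  "polar_decomposition ip B U \<longleftrightarrow>
     adjointable ip B \<and> partial_isometry ip U \<and> B = U \<circ> op_abs ip B \<and>
     orthogonally_complemented ip (closure (range (adj ip B))) \<and>
     adj ip U \<circ> U = proj_onto ip (closure (range (adj ip B)))"

end

theory Submission
  imports Defs
begin

text \<open>
  Write \<open>P = U\<^sub>T\<^sup>* U\<^sub>T\<close> and \<open>Q = U\<^sub>S U\<^sub>S\<^sup>*\<close>, so that \<open>W = P B Q\<close>, \<open>P Y = Y = Y Q\<close>.  From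
  \<open>T = U\<^sub>T |T|\<close> and \<open>|S\<^sup>*| = U\<^sub>S |S| U\<^sub>S\<^sup>*\<close>, that is \<open>S = |S\<^sup>*| U\<^sub>S\<close>, one gets \<open>X = U\<^sub>T Y U\<^sub>S\<close> and
  \<open>U\<^sub>T B U\<^sub>S = U\<^sub>T W U\<^sub>S\<close>, and these relations can be inverted with \<open>U\<^sub>T\<^sup>*\<close> and \<open>U\<^sub>S\<^sup>*\<close>.  Polar
  decompositions are carried along by such a pair of partial isometries
  (\<open>polar_decomposition_transfer\<close>), which gives the equivalence of (i) and (ii).

  Everything about polar decompositions is reduced to one criterion: \<open>Y = W |Y|\<close> is the polar
  decomposition iff some positive \<open>N\<close> satisfies \<open>Y = W N\<close>, \<open>W\<^sup>* Y = N\<close>, and \<open>W\<^sup>* W\<close> maps into the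
  closure of the range of \<open>N\<close> (\<open>polar_decomposition_if_factors\<close>,
  \<open>factors_if_polar_decomposition\<close>).  Then \<open>N = |Y|\<close>, and \<open>N\<close> and \<open>Y\<^sup>*\<close> have the same range.

  For (iii) and (iv) the candidate is \<open>N = B\<^sup>* Y\<close>.  If it is positive and \<open>B B\<^sup>* Y = Y\<close>, then the two
  equations of the criterion are immediate, and either range condition yields the third part.
  Conversely, (ii) says \<open>|Y| = Q B\<^sup>* Y\<close>, so that \<open>Q B\<^sup>*\<close> is isometric on the range of \<open>Y\<close>; as \<open>B\<^sup>*\<close> is a
  contraction, this forces \<open>Q B\<^sup>* Y = B\<^sup>* Y\<close> and \<open>B B\<^sup>* Y = Y\<close> (\<open>contraction_isometric_vector\<close>).

  All this rests on square roots of positive operators, with positivity given by spectra.  The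
  bridge is a norm condition: a self-adjoint \<open>T\<close> has nonnegative spectrum iff \<open>\<parallel>t - T\<parallel> \<le> t\<close> for
  some \<open>t \<ge> 0\<close> (\<open>op_positive_iff\<close>).  Such operators obviously form a convex cone, and have square
  roots by an explicit iteration which converges even when \<open>\<parallel>1 - T/t\<parallel> = 1\<close>; norms of commuting
  operators are then compared through the identity behind \<open>norm_diff_squares_le\<close>.  The theory is
  developed for inner products with values in a C*-algebra that satisfy the Cauchy-Schwarz
  inequality.  Applied to the algebra itself, with \<open>\<langle>a, b\<rangle> = a\<^sup>* b\<close>, it gives the order-norm inequalities for positive elements,
  from which the Cauchy-Schwarz inequality in an arbitrary Hilbert module follows; then it is
  applied again to the module.
\<close>

section \<open>Square roots by iteration\<close>

text \<open>
  If \<open>Y\<close> is a fixed point of \<open>Y \<mapsto> (D + Y\<^sup>2) / 2\<close>, then \<open>(1 - Y)\<^sup>2 = 1 - D\<close>.  Hence the limit of this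
  iteration yields a square root of \<open>1 - D\<close>.
\<close>

primrec sqrt_iterate :: "('h::real_vector \<Rightarrow> 'h) \<Rightarrow> nat \<Rightarrow> 'h \<Rightarrow> 'h" where
  "sqrt_iterate D 0 x = 0"
| "sqrt_iterate D (Suc n) x = (1/2) *\<^sub>R (D x + sqrt_iterate D n (sqrt_iterate D n x))"

text \<open>
  The same iteration for the scalar \<open>D = 1\<close>.  It increases to a limit, and it dominates the iteration
  for every operator of norm at most \<open>1\<close>, including the case of norm \<open>1\<close>, in which no geometric
  estimate is available.
\<close>

primrec sqrt_majorant :: "nat \<Rightarrow> real" where
  "sqrt_majorant 0 = 0"
| "sqrt_majorant (Suc n) = (1 + (sqrt_majorant n)\<^sup>2) / 2"

lemma sqrt_majorant_bounds: "0 \<le> sqrt_majorant n \<and> sqrt_majorant n \<le> 1"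
proof (induction n)
  case (Suc n)
  then have "(sqrt_majorant n)\<^sup>2 \<le> 1"
    by (simp add: power_le_one)
  then show ?case by simp
qed simp

lemma sqrt_majorant_incseq: "incseq sqrt_majorant"
proof (rule incseq_SucI)
  fix n
  have "0 \<le> (1 - sqrt_majorant n)\<^sup>2" by simp
  then show "sqrt_majorant n \<le> sqrt_majorant (Suc n)"
    by (simp add: power2_eq_square algebra_simps)
qed

lemma sqrt_iterate_bounded_linear:
  assumes "bounded_linear D"
  shows "bounded_linear (sqrt_iterate D n)"
proof (induction n)
  case 0
  have "sqrt_iterate D 0 = (\<lambda>x. 0)" by auto
  then show ?case by (simp add: bounded_linear_zero)
next
  case (Suc n)
  have "bounded_linear (\<lambda>x. (1/2) *\<^sub>R (D x + sqrt_iterate D n (sqrt_iterate D n x)))"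
    by (intro bounded_linear_scaleR_right[THEN bounded_linear_compose] bounded_linear_add assms
        bounded_linear_compose[OF Suc Suc])
  moreover have "sqrt_iterate D (Suc n) =
      (\<lambda>x. (1/2) *\<^sub>R (D x + sqrt_iterate D n (sqrt_iterate D n x)))" by auto
  ultimately show ?case by metis
qed

lemma sqrt_iterate_norm:
  assumes D: "\<And>x. norm (D x) \<le> norm x"
  shows "norm (sqrt_iterate D n x) \<le> sqrt_majorant n * norm x"
proof (induction n arbitrary: x)
  case (Suc n)
  have "norm (sqrt_iterate D n (sqrt_iterate D n x)) \<le> sqrt_majorant n * (sqrt_majorant n * norm x)"
    using Suc[of "sqrt_iterate D n x"] Suc[of x] sqrt_majorant_bounds[of n]
    by (meson mult_left_mono order_trans)
  then have "norm (D x + sqrt_iterate D n (sqrt_iterate D n x))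
      \<le> norm x + sqrt_majorant n * (sqrt_majorant n * norm x)"
    using D[of x] by (meson add_mono norm_triangle_le)
  then show ?case
    unfolding sqrt_iterate.simps norm_scaleR by (simp add: algebra_simps power2_eq_square)
qed simp

lemma sqrt_iterate_commute:
  assumes K: "linear K" and KD: "\<And>x. K (D x) = D (K x)"
  shows "K (sqrt_iterate D n x) = sqrt_iterate D n (K x)"
proof (induction n arbitrary: x)
  case 0
  show ?case using linear_0[OF K] by simp
next
  case (Suc n)
  show ?case
    by (simp add: linear_cmul[OF K] linear_add[OF K] KD Suc)
qed

text \<open>
  The induction works because \<open>Y\<^sup>2 - Z\<^sup>2 = Y (Y - Z) + (Y - Z) Z\<close>: the norm of the left-hand side is
  estimated exactly as the scalars \<open>y\<^sup>2 - z\<^sup>2 = (y + z) (y - z)\<close> behave.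
\<close>

lemma sqrt_iterate_step:
  assumes D: "bounded_linear D" and norm: "\<And>x. norm (D x) \<le> norm x"
  shows "norm (sqrt_iterate D (Suc n) x - sqrt_iterate D n x)
           \<le> (sqrt_majorant (Suc n) - sqrt_majorant n) * norm x"
proof (induction n arbitrary: x)
  case 0
  show ?case using norm[of x] by simp
next
  case (Suc n)
  let ?y = sqrt_majorant and ?Y = "sqrt_iterate D"
  let ?d = "?y (Suc n) - ?y n"
  have d: "0 \<le> ?d" using sqrt_majorant_incseq by (simp add: incseq_SucD del: sqrt_majorant.simps)
  interpret Y: bounded_linear "?Y (Suc n)" by (rule sqrt_iterate_bounded_linear[OF D])
  have eq: "?Y (Suc (Suc n)) x - ?Y (Suc n) x = (1/2) *\<^sub>R
      (?Y (Suc n) (?Y (Suc n) x - ?Y n x) + (?Y (Suc n) (?Y n x) - ?Y n (?Y n x)))"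
  proof -
    have "?Y (Suc (Suc n)) x - ?Y (Suc n) x =
       (1/2) *\<^sub>R (?Y (Suc n) (?Y (Suc n) x) - ?Y n (?Y n x))"
      by (subst (1 2) sqrt_iterate.simps(2)) (simp add: algebra_simps del: sqrt_iterate.simps)
    then show ?thesis by (simp add: Y.diff del: sqrt_iterate.simps)
  qed
  have "norm (?Y (Suc n) (?Y (Suc n) x - ?Y n x)) \<le> ?y (Suc n) * (?d * norm x)"
    using sqrt_iterate_norm[OF norm, of "Suc n" "?Y (Suc n) x - ?Y n x"] Suc[of x]
      sqrt_majorant_bounds[of "Suc n"] by (meson mult_left_mono order_trans)
  moreover have "norm (?Y (Suc n) (?Y n x) - ?Y n (?Y n x)) \<le> ?d * (?y n * norm x)"
    using Suc[of "?Y n x"] sqrt_iterate_norm[OF norm, of n x] d by (meson mult_left_mono order_trans)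
  ultimately have "norm (?Y (Suc (Suc n)) x - ?Y (Suc n) x)
      \<le> 1/2 * (?y (Suc n) * (?d * norm x) + ?d * (?y n * norm x))"
    unfolding eq norm_scaleR
    by (smt (verit) mult_left_mono norm_triangle_ineq abs_of_pos half_gt_zero zero_less_one)
  also have "\<dots> = (?y (Suc (Suc n)) - ?y (Suc n)) * norm x"
  proof -
    have "?y (Suc (Suc n)) - ?y (Suc n) = ((?y (Suc n))\<^sup>2 - (?y n)\<^sup>2) / 2"
      by (subst (1 2) sqrt_majorant.simps(2)) (simp add: field_simps del: sqrt_majorant.simps)
    then show ?thesis
      by (simp only:) (simp add: power2_eq_square field_simps del: sqrt_majorant.simps)
  qed
  finally show ?case .
qed

lemma sqrt_iterate_diff:
  assumes D: "bounded_linear D" and norm: "\<And>x. norm (D x) \<le> norm x" and mn: "n \<le> m"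
  shows "norm (sqrt_iterate D m x - sqrt_iterate D n x)
           \<le> (sqrt_majorant m - sqrt_majorant n) * norm x"
  using mn
proof (induction m rule: dec_induct)
  case (step m)
  have "norm (sqrt_iterate D (Suc m) x - sqrt_iterate D n x) \<le>
    norm (sqrt_iterate D (Suc m) x - sqrt_iterate D m x) + norm (sqrt_iterate D m x - sqrt_iterate D n x)"
    by (metis diff_add_cancel add_diff_eq norm_triangle_ineq)
  then show ?case
    using step sqrt_iterate_step[OF D norm, of m x]
    by (simp add: algebra_simps del: sqrt_majorant.simps sqrt_iterate.simps)
qed simp

text \<open>
  By the majorant, the iterates form a Cauchy sequence at every vector.  Pointwise convergence
  suffices to pass to the limit in \<open>Y (Y x)\<close>, since all iterates are contractions.
\<close>

lemma sqrt_iterate_limit: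
  fixes D :: "'h::banach \<Rightarrow> 'h"
  assumes D: "bounded_linear D" and norm: "\<And>x. norm (D x) \<le> norm x"
  obtains Y where "\<And>x. (\<lambda>n. sqrt_iterate D n x) \<longlonglongrightarrow> Y x"
    and "\<And>x. norm (Y x) \<le> norm x" and "\<And>x. 2 *\<^sub>R Y x = D x + Y (Y x)"
proof -
  let ?Y = "sqrt_iterate D"
  have "convergent sqrt_majorant"
    using sqrt_majorant_incseq sqrt_majorant_bounds by (metis convergent_def incseq_convergent)
  then have cauchy: "Cauchy sqrt_majorant" by (rule convergent_Cauchy)
  have "Cauchy (\<lambda>n. ?Y n x)" for x
  proof (rule metric_CauchyI)
    fix e :: real assume e: "e > 0"
    then have "e / (norm x + 1) > 0" by (simp add: add_nonneg_pos)
    then obtain M where M: "\<And>m n. m \<ge> M \<Longrightarrow> n \<ge> M \<Longrightarrow>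
        dist (sqrt_majorant m) (sqrt_majorant n) < e / (norm x + 1)"
      using metric_CauchyD[OF cauchy] by metis
    have small: "norm (?Y m x - ?Y n x) < e" if "n \<ge> M" "m \<ge> n" for m n
    proof -
      have a: "sqrt_majorant m - sqrt_majorant n < e / (norm x + 1)"
        using M[of m n] that by (simp add: dist_real_def)
      have b: "0 < norm x + 1" by (simp add: add_nonneg_pos)
      have "0 \<le> sqrt_majorant m - sqrt_majorant n"
        using sqrt_majorant_incseq that(2) by (simp add: incseqD)
      then have "(sqrt_majorant m - sqrt_majorant n) * norm x
           \<le> (sqrt_majorant m - sqrt_majorant n) * (norm x + 1)"
        by (simp add: mult_left_mono)
      also have "\<dots> < e" using a b by (simp add: pos_less_divide_eq)
      finally show ?thesis using sqrt_iterate_diff[OF D norm that(2), of x] by linarith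
    qed
    have "dist (?Y m x) (?Y n x) < e" if "m \<ge> M" "n \<ge> M" for m n
      using small[of m n] small[of n m] that by (metis dist_commute dist_norm nle_le)
    then show "\<exists>M. \<forall>m\<ge>M. \<forall>n\<ge>M. dist (?Y m x) (?Y n x) < e" by blast
  qed
  then have conv: "convergent (\<lambda>n. ?Y n x)" for x by (simp add: Cauchy_convergent_iff)
  define Y where "Y x = lim (\<lambda>n. ?Y n x)" for x
  have Y: "(\<lambda>n. ?Y n x) \<longlonglongrightarrow> Y x" for x
    using conv[of x] by (simp add: Y_def convergent_LIMSEQ_iff)
  have n1: "norm (?Y n x) \<le> norm x" for n x
    using sqrt_iterate_norm[OF norm, of n x] sqrt_majorant_bounds[of n]
    by (meson mult_left_le_one_le norm_ge_zero order_trans)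
  have nY: "norm (Y x) \<le> norm x" for x
    using tendsto_norm[OF Y] by (rule LIMSEQ_le_const2) (use n1 in blast)
  have "2 *\<^sub>R Y x = D x + Y (Y x)" for x
  proof -
    have "(\<lambda>n. ?Y n (?Y n x)) \<longlonglongrightarrow> Y (Y x)"
    proof -
      have "(\<lambda>n. ?Y n (?Y n x - Y x)) \<longlonglongrightarrow> 0"
      proof (rule Lim_null_comparison)
        show "\<forall>\<^sub>F n in sequentially. norm (?Y n (?Y n x - Y x)) \<le> norm (?Y n x - Y x)"
          using n1 by simp
        show "(\<lambda>n. norm (?Y n x - Y x)) \<longlonglongrightarrow> 0"
          using Y[of x] LIM_zero tendsto_norm_zero by blast
      qed
      from tendsto_add[OF this Y[of "Y x"]] show ?thesis
        by (simp add: linear_diff[OF bounded_linear.linear[OF sqrt_iterate_bounded_linear[OF D]]])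
    qed
    then have "(\<lambda>n. (1/2) *\<^sub>R (D x + ?Y n (?Y n x))) \<longlonglongrightarrow> (1/2) *\<^sub>R (D x + Y (Y x))"
      by (intro tendsto_intros)
    moreover have "(\<lambda>n. (1/2) *\<^sub>R (D x + ?Y n (?Y n x))) \<longlonglongrightarrow> Y x"
      using LIMSEQ_Suc[OF Y[of x]] by simp
    ultimately have "Y x = (1/2) *\<^sub>R (D x + Y (Y x))" by (metis LIMSEQ_unique)
    then have "2 *\<^sub>R Y x = 2 *\<^sub>R ((1/2) *\<^sub>R (D x + Y (Y x)))" by (rule arg_cong)
    then show ?thesis by simp
  qed
  then show ?thesis using that Y nY by blast
qed

section \<open>Inner products with values in a C*-algebra\<close>

lemma scaleC_one [simp]: "1 *\<^sub>C x = (x :: 'a::complex_banach)"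
  using scaleR_scaleC[of 1 x] by simp

lemma scaleC_zero_left [simp]: "0 *\<^sub>C x = (0 :: 'a::complex_banach)"
  using scaleR_scaleC[of 0 x] by simp

lemma scaleC_minus_left: "(- c) *\<^sub>C x = - (c *\<^sub>C (x :: 'a::complex_banach))"
  using scaleC_add_left[of "- c" c x] by (simp add: eq_neg_iff_add_eq_0)

lemma scaleC_minus_right: "c *\<^sub>C (- x) = - (c *\<^sub>C (x :: 'a::complex_banach))"
proof -
  have "c *\<^sub>C (- x) + c *\<^sub>C x = c *\<^sub>C (0::'a)"
    using scaleC_add_right[of c "- x" x] by simp
  also have "\<dots> = 0" using norm_scaleC[of c "0::'a"] by simp
  finally show ?thesis by (simp add: eq_neg_iff_add_eq_0)
qed

lemma scaleC_diff_left: "(c - d) *\<^sub>C x = c *\<^sub>C x - d *\<^sub>C (x :: 'a::complex_banach)"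
  using scaleC_add_left[of c "- d" x] by (simp add: scaleC_minus_left)

lemma scaleC_diff_right: "c *\<^sub>C (x - y) = c *\<^sub>C x - c *\<^sub>C (y :: 'a::complex_banach)"
  using scaleC_add_right[of c x "- y"] by (simp add: scaleC_minus_right)

lemma star_scaleR: "star (r *\<^sub>R a) = r *\<^sub>R star (a :: 'a::cstar_algebra)"
  by (simp add: scaleR_scaleC star_scaleC)

lemma norm_star: "norm (star a) = norm (a :: 'a::cstar_algebra)"
proof -
  have le: "norm b \<le> norm (star b)" for b :: 'a
  proof (cases "b = 0")
    case False
    have "norm b * norm b \<le> norm (star b) * norm b"
      using cstar_identity[of b] norm_mult_ineq[of "star b" b] by (simp add: power2_eq_square)
    then show ?thesis using False by simp
  qed simp
  show ?thesis using le[of a] le[of "star a"] by (simp add: star_star)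
qed

text \<open>
  The common core of two situations: a Hilbert module, and the C*-algebra with \<open>\<langle>a, b\<rangle> = a\<^sup>* b\<close>.
\<close>

locale cstar_valued_form =
  fixes ip :: "'h::complex_banach \<Rightarrow> 'h \<Rightarrow> 'a::cstar_algebra"
  assumes ip_add_right: "ip x (y + z) = ip x y + ip x z"
    and ip_scaleC_right: "ip x (c *\<^sub>C y) = c *\<^sub>C ip x y"
    and ip_star: "star (ip x y) = ip y x"
    and norm_ip: "norm x = sqrt (norm (ip x x))"
begin

lemma ip_add_left: "ip (x + y) z = ip x z + ip y z"
  using ip_add_right[of z x y] star_add[of "ip z x" "ip z y"] ip_star[of z "x + y"]
  by (simp add: ip_star)

lemma ip_scaleC_left: "ip (c *\<^sub>C x) y = cnj c *\<^sub>C ip x y"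
  using ip_scaleC_right[of y c x] star_scaleC[of c "ip y x"] ip_star[of y "c *\<^sub>C x"]
  by (simp add: ip_star)

lemma ip_scaleR_right: "ip x (r *\<^sub>R y) = r *\<^sub>R ip x y"
  by (simp add: scaleR_scaleC ip_scaleC_right)

lemma ip_scaleR_left: "ip (r *\<^sub>R x) y = r *\<^sub>R ip x y"
  by (simp add: scaleR_scaleC ip_scaleC_left)

lemma ip_zero [simp]: "ip x 0 = 0" "ip 0 x = 0"
  using ip_scaleR_right[of x 0 0] ip_scaleR_left[of 0 0 x] by auto

lemma ip_minus_right: "ip x (- y) = - ip x y"
  using ip_scaleR_right[of x "-1" y] by simp

lemma ip_minus_left: "ip (- x) y = - ip x y"
  using ip_scaleR_left[of "-1" x y] by simp

lemma ip_diff_right: "ip x (y - z) = ip x y - ip x z"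
  using ip_add_right[of x y "- z"] by (simp add: ip_minus_right)

lemma ip_diff_left: "ip (x - y) z = ip x z - ip y z"
  using ip_add_left[of x "- y" z] by (simp add: ip_minus_left)

lemmas ip_linear = ip_add_left ip_add_right ip_diff_left ip_diff_right ip_minus_left
  ip_minus_right ip_scaleR_left ip_scaleR_right ip_scaleC_left ip_scaleC_right

lemma power2_norm_ip: "(norm x)\<^sup>2 = norm (ip x x)"
  by (simp add: norm_ip)

lemma ip_self_eq_0: "ip x x = 0 \<Longrightarrow> x = 0"
  using norm_ip[of x] by simp

lemma ip_ext: "(\<And>z. ip z x = ip z y) \<Longrightarrow> x = y"
  using ip_self_eq_0[of "x - y"] by (simp add: ip_diff_right)

end

text \<open>
  The Cauchy-Schwarz inequality is separated from the other axioms because its proof for Hilbert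
  modules uses the theory of this locale for the algebra of coefficients.
\<close>

locale cstar_valued_ip = cstar_valued_form ip
  for ip :: "'h::complex_banach \<Rightarrow> 'h \<Rightarrow> 'a::cstar_algebra" +
  assumes cauchy_schwarz: "norm (ip x y) \<le> norm x * norm y"
begin

lemma bounded_linear_ip: "bounded_linear (ip x)"
  by (rule bounded_linear_intro[where K = "norm x"])
    (auto simp: ip_linear mult.commute[of _ "norm x"] cauchy_schwarz)

definition adjoint_pair :: "('h \<Rightarrow> 'h) \<Rightarrow> ('h \<Rightarrow> 'h) \<Rightarrow> bool" where
  "adjoint_pair S R \<longleftrightarrow> (\<forall>x y. ip (S x) y = ip x (R y))"

lemma adjoint_pairD: "adjoint_pair S R \<Longrightarrow> ip (S x) y = ip x (R y)"
  by (simp add: adjoint_pair_def)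

lemma adjoint_pair_sym: "adjoint_pair S R \<Longrightarrow> adjoint_pair R S"
  using ip_star by (simp add: adjoint_pair_def) metis

lemma adjoint_pair_unique: "adjoint_pair S R \<Longrightarrow> adjoint_pair S R' \<Longrightarrow> R = R'"
  by (rule ext, rule ip_ext) (simp add: adjoint_pair_def)

lemma adjoint_pair_comp:
  "adjoint_pair S R \<Longrightarrow> adjoint_pair S' R' \<Longrightarrow> adjoint_pair (\<lambda>x. S (S' x)) (\<lambda>x. R' (R x))"
  by (simp add: adjoint_pair_def)

lemma adjoint_pair_id: "adjoint_pair (\<lambda>x. x) (\<lambda>x. x)"
  by (simp add: adjoint_pair_def)

lemma adjoint_pair_add:
  "adjoint_pair S R \<Longrightarrow> adjoint_pair S' R' \<Longrightarrow> adjoint_pair (\<lambda>x. S x + S' x) (\<lambda>x. R x + R' x)"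
  by (simp add: adjoint_pair_def ip_linear)

lemma adjoint_pair_diff:
  "adjoint_pair S R \<Longrightarrow> adjoint_pair S' R' \<Longrightarrow> adjoint_pair (\<lambda>x. S x - S' x) (\<lambda>x. R x - R' x)"
  by (simp add: adjoint_pair_def ip_linear)

lemma adjoint_pair_scaleR:
  "adjoint_pair S R \<Longrightarrow> adjoint_pair (\<lambda>x. r *\<^sub>R S x) (\<lambda>x. r *\<^sub>R R x)"
  by (simp add: adjoint_pair_def ip_linear)

lemma adjoint_pair_scaleC:
  "adjoint_pair S R \<Longrightarrow> adjoint_pair (\<lambda>x. c *\<^sub>C S x) (\<lambda>x. cnj c *\<^sub>C R x)"
  by (simp add: adjoint_pair_def ip_linear)

lemmas adjoint_pair_intros = adjoint_pair_id adjoint_pair_add adjoint_pair_diff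
  adjoint_pair_scaleR adjoint_pair_scaleC

lemma adjoint_pair_plus: "adjoint_pair S R \<Longrightarrow> S (x + y) = S x + S y"
  by (rule ip_ext) (simp add: adjoint_pairD[OF adjoint_pair_sym, symmetric] ip_add_right)

lemma adjoint_pair_cscale: "adjoint_pair S R \<Longrightarrow> S (c *\<^sub>C x) = c *\<^sub>C S x"
  by (rule ip_ext) (simp add: adjoint_pairD[OF adjoint_pair_sym, symmetric] ip_scaleC_right)

text \<open>
  Uniform boundedness: for \<open>\<parallel>x\<parallel> \<le> 1\<close> the functionals \<open>y \<mapsto> \<langle>S x, y\<rangle> = \<langle>x, R y\<rangle>\<close> are pointwise bounded by
  \<open>\<parallel>R y\<parallel>\<close>, hence by Baire's theorem uniformly bounded on a ball; evaluating them at multiples of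
  \<open>S x\<close> bounds \<open>\<parallel>S x\<parallel>\<close>.
\<close>

lemma adjoint_pair_bounded_linear:
  assumes SR: "adjoint_pair S R"
  shows "bounded_linear S"
proof -
  have add: "S (x + y) = S x + S y" for x y by (rule adjoint_pair_plus[OF SR])
  have scale: "S (r *\<^sub>R x) = r *\<^sub>R S x" for r x
    by (simp add: scaleR_scaleC adjoint_pair_cscale[OF SR])
  define A where "A n = {y. \<forall>x. norm x \<le> 1 \<longrightarrow> norm (ip (S x) y) \<le> real n}" for n
  have closed_A: "closed (A n)" for n
  proof -
    have "A n = (\<Inter>x\<in>{x. norm x \<le> 1}. {y. norm (ip (S x) y) \<le> real n})"
      by (auto simp: A_def)
    moreover have "closed {y. norm (ip (S x) y) \<le> real n}" for x
      by (intro closed_Collect_le continuous_intros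
          bounded_linear.continuous_on[OF bounded_linear_ip])
    ultimately show ?thesis by auto
  qed
  have "y \<in> \<Union>(range A)" for y
  proof -
    obtain n where n: "norm (R y) \<le> real n" using real_arch_simple by blast
    have "norm (ip (S x) y) \<le> real n" if "norm x \<le> 1" for x
    proof -
      have "norm (ip (S x) y) \<le> norm x * norm (R y)"
        using adjoint_pairD[OF SR] cauchy_schwarz by metis
      also have "\<dots> \<le> norm (R y)" using that by (simp add: mult_left_le_one_le)
      finally show ?thesis using n by linarith
    qed
    then show ?thesis by (auto simp: A_def)
  qed
  then have cover: "\<Union>(range A) = UNIV" by blast
  have "\<exists>n. interior (A n) \<noteq> {}"
  proof (rule ccontr)
    assume "\<not> ?thesis"
    then have "euclidean interior_of \<Union>(range A) = {}"
      using closed_A by (intro Baire_category_alt) (auto simp: completely_metrizable_space_euclidean)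
    then show False using cover by simp
  qed
  then obtain n y0 e where e: "e > 0" "ball y0 e \<subseteq> A n"
    by (auto simp: mem_interior ex_in_conv[symmetric])
  have unit: "norm (S x) \<le> 4 * real n / e" if x: "norm x \<le> 1" for x
  proof (cases "S x = 0")
    case False
    \<comment> \<open>\<open>w\<close> is the multiple of \<open>S x\<close> that stays in the ball when it is added to the centre \<open>y0\<close>.\<close>
    define r where "r = e / 2 / norm (S x)"
    define w where "w = r *\<^sub>R S x"
    have r: "r > 0" using False e by (simp add: r_def)
    have "norm w = e / 2" using False e by (simp add: w_def r_def)
    then have "y0 + w \<in> ball y0 e" "y0 \<in> ball y0 e" using e by (auto simp: dist_norm)
    then have "y0 + w \<in> A n" "y0 \<in> A n" using e(2) by blast+
    then have "norm (ip (S x) (y0 + w)) \<le> n" "norm (ip (S x) y0) \<le> n"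
      using x by (auto simp: A_def)
    moreover have "ip (S x) w = ip (S x) (y0 + w) - ip (S x) y0" by (simp add: ip_linear)
    ultimately have "norm (ip (S x) w) \<le> 2 * real n"
      using norm_triangle_ineq4[of "ip (S x) (y0 + w)" "ip (S x) y0"] by simp
    moreover have "norm (ip (S x) w) = e / 2 * norm (S x)"
    proof -
      have "norm (ip (S x) w) = r * (norm (S x))\<^sup>2"
        using r by (simp add: w_def ip_scaleR_right power2_norm_ip)
      then show ?thesis using False by (simp add: r_def power2_eq_square)
    qed
    ultimately have "e * norm (S x) \<le> 4 * real n" by simp
    then show ?thesis using e by (simp add: pos_le_divide_eq mult.commute)
  qed (use e in simp)
  show ?thesis
  proof (rule bounded_linear_intro[OF add scale])
    fix x show "norm (S x) \<le> norm x * (4 * real n / e)"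
    proof (cases "x = 0")
      case True
      then show ?thesis using scale[of 0 0] by simp
    next
      case False
      have "norm (S ((1 / norm x) *\<^sub>R x)) \<le> 4 * real n / e"
        by (rule unit) (use False in simp)
      then show ?thesis using False e by (simp add: scale field_simps)
    qed
  qed
qed

lemma adjoint_pair_diff_arg: "adjoint_pair S R \<Longrightarrow> S (x - y) = S x - S y"
  by (drule adjoint_pair_bounded_linear) (rule linear_diff[OF bounded_linear.linear])

lemma adjoint_pair_scaleR_arg: "adjoint_pair S R \<Longrightarrow> S (r *\<^sub>R x) = r *\<^sub>R S x"
  unfolding scaleR_scaleC by (rule adjoint_pair_cscale)

lemma adjoint_pair_zero_arg: "adjoint_pair S R \<Longrightarrow> S 0 = 0"
  using adjoint_pair_scaleR_arg[of S R 0 0] by simp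

lemmas adjoint_pair_arg = adjoint_pair_plus adjoint_pair_diff_arg adjoint_pair_scaleR_arg
  adjoint_pair_cscale

lemma adjoint_pair_bound:
  assumes "adjoint_pair S R"
  obtains m where "m > 0" "\<And>x. norm (S x) \<le> m * norm x"
  using bounded_linear.pos_bounded[OF adjoint_pair_bounded_linear[OF assms]] that
  by (auto simp: mult.commute)

lemma bounded_linear_ip_left: "bounded_linear (\<lambda>x. ip x y)"
  by (rule bounded_linear_intro[where K = "norm y"]) (auto simp: ip_linear cauchy_schwarz)

lemma selfadjoint_sq_eq_0:
  assumes "adjoint_pair C C" "C (C x) = 0"
  shows "C x = 0"
  by (rule ip_self_eq_0) (simp add: adjoint_pairD[OF assms(1)] assms(2))

section \<open>Positive operators and their square roots\<close>

text \<open>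
  Numerically, \<open>|t - s| \<le> t\<close> means \<open>0 \<le> s \<le> 2 t\<close>.  In this form, positivity of a self-adjoint operator is
  visibly stable under sums, and it gives square roots directly.  It is equivalent to nonnegativity
  of the spectrum by \<open>op_positive_iff\<close> below.
\<close>

definition norm_positive :: "('h \<Rightarrow> 'h) \<Rightarrow> bool" where
  "norm_positive T \<longleftrightarrow>
     adjoint_pair T T \<and> (\<exists>t\<ge>0. \<forall>x. norm (t *\<^sub>R x - T x) \<le> t * norm x)"

lemma norm_positive_selfadjoint: "norm_positive T \<Longrightarrow> adjoint_pair T T"
  by (simp add: norm_positive_def)

lemma norm_positiveI:
  "adjoint_pair T T \<Longrightarrow> t \<ge> 0 \<Longrightarrow> (\<And>x. norm (t *\<^sub>R x - T x) \<le> t * norm x) \<Longrightarrow> norm_positive T"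
  by (auto simp: norm_positive_def)

lemma norm_positive_add:
  assumes "norm_positive S" "norm_positive T"
  shows "norm_positive (\<lambda>x. S x + T x)"
proof -
  obtain s where s: "s \<ge> 0" "\<And>x. norm (s *\<^sub>R x - S x) \<le> s * norm x"
    using assms by (auto simp: norm_positive_def)
  obtain t where t: "t \<ge> 0" "\<And>x. norm (t *\<^sub>R x - T x) \<le> t * norm x"
    using assms by (auto simp: norm_positive_def)
  show ?thesis
  proof (rule norm_positiveI)
    show "adjoint_pair (\<lambda>x. S x + T x) (\<lambda>x. S x + T x)"
      using assms by (intro adjoint_pair_intros norm_positive_selfadjoint)
    fix x
    have "(s + t) *\<^sub>R x - (S x + T x) = (s *\<^sub>R x - S x) + (t *\<^sub>R x - T x)"
      by (simp add: algebra_simps)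
    then show "norm ((s + t) *\<^sub>R x - (S x + T x)) \<le> (s + t) * norm x"
      using norm_triangle_le[OF add_mono[OF s(2)[of x] t(2)[of x]]] by (simp add: algebra_simps)
  qed (use s t in simp)
qed

lemma norm_positive_scaleR:
  assumes "norm_positive T" "r \<ge> 0"
  shows "norm_positive (\<lambda>x. r *\<^sub>R T x)"
proof -
  obtain t where t: "t \<ge> 0" "\<And>x. norm (t *\<^sub>R x - T x) \<le> t * norm x"
    using assms by (auto simp: norm_positive_def)
  show ?thesis
  proof (rule norm_positiveI)
    show "adjoint_pair (\<lambda>x. r *\<^sub>R T x) (\<lambda>x. r *\<^sub>R T x)"
      using assms by (intro adjoint_pair_intros norm_positive_selfadjoint)
    fix x
    have "(r * t) *\<^sub>R x - r *\<^sub>R T x = r *\<^sub>R (t *\<^sub>R x - T x)" by (simp add: algebra_simps)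
    then show "norm ((r * t) *\<^sub>R x - r *\<^sub>R T x) \<le> r * t * norm x"
      using mult_left_mono[OF t(2)[of x] assms(2)] assms(2) by (simp add: mult.assoc)
  qed (use t assms in simp)
qed

lemma norm_positive_bound_minus:
  assumes T: "adjoint_pair T T" and m: "m \<ge> 0" "\<And>x. norm (T x) \<le> m * norm x"
  shows "norm_positive (\<lambda>x. m *\<^sub>R x - T x)"
proof (rule norm_positiveI)
  show "adjoint_pair (\<lambda>x. m *\<^sub>R x - T x) (\<lambda>x. m *\<^sub>R x - T x)"
    using T by (intro adjoint_pair_intros)
qed (use m in auto)

text \<open>
  If \<open>\<parallel>t - T\<parallel> \<le> t\<close> with \<open>t > 0\<close>, then \<open>D = 1 - T/t\<close> is a contraction, and \<open>T = t (1 - D)\<close> has the root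
  \<open>\<surd>t (1 - Y)\<close>, where \<open>Y\<close> is the limit of the iteration for \<open>D\<close>.  As a limit of polynomials in \<open>T\<close>, the root
  commutes with everything that commutes with \<open>T\<close>.
\<close>

lemma norm_positive_root:
  assumes "norm_positive T"
  obtains R where "norm_positive R" "\<And>x. R (R x) = T x"
    "\<And>K x. bounded_linear K \<Longrightarrow> (\<And>x. K (T x) = T (K x)) \<Longrightarrow> K (R x) = R (K x)"
proof -
  obtain t0 where t0: "t0 \<ge> 0" "\<And>x. norm (t0 *\<^sub>R x - T x) \<le> t0 * norm x"
    using assms by (auto simp: norm_positive_def)
  \<comment> \<open>\<open>t0\<close> may be \<open>0\<close>, but the root is scaled by \<open>1 / t\<close>.\<close>
  define t where "t = t0 + 1"
  have t: "t > 0" using t0 by (simp add: t_def)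
  have tT: "norm (t *\<^sub>R x - T x) \<le> t * norm x" for x
  proof -
    have "t *\<^sub>R x - T x = (t0 *\<^sub>R x - T x) + x" by (simp add: t_def algebra_simps)
    then show ?thesis
      using norm_triangle_le[OF add_right_mono[OF t0(2)[of x], of "norm x"]]
      by (simp add: t_def algebra_simps)
  qed
  have T: "adjoint_pair T T" using assms by (rule norm_positive_selfadjoint)
  define D where "D x = x - (1/t) *\<^sub>R T x" for x
  have Dself: "adjoint_pair D D"
    unfolding D_def using T by (intro adjoint_pair_intros)
  have Dbl: "bounded_linear D" by (rule adjoint_pair_bounded_linear[OF Dself])
  have Dnorm: "norm (D x) \<le> norm x" for x
  proof -
    have "D x = (1/t) *\<^sub>R (t *\<^sub>R x - T x)" using t by (simp add: D_def algebra_simps)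
    then have "norm (D x) = norm (t *\<^sub>R x - T x) / t" using t by simp
    then show ?thesis using tT[of x] t by (simp add: pos_divide_le_eq mult.commute)
  qed
  obtain Y where Y: "\<And>x. (\<lambda>n. sqrt_iterate D n x) \<longlonglongrightarrow> Y x"
    and nY: "\<And>x. norm (Y x) \<le> norm x" and eqY: "\<And>x. 2 *\<^sub>R Y x = D x + Y (Y x)"
    using sqrt_iterate_limit[OF Dbl Dnorm] by metis
  have iter: "adjoint_pair (sqrt_iterate D n) (sqrt_iterate D n)" for n
  proof (induction n)
    case 0
    show ?case by (simp add: adjoint_pair_def)
  next
    case (Suc n)
    show ?case
      unfolding adjoint_pair_def
      by (simp add: ip_linear adjoint_pairD[OF Dself] adjoint_pairD[OF Suc])
  qed
  have Yself: "adjoint_pair Y Y"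
    unfolding adjoint_pair_def
  proof (intro allI)
    fix x y
    have "(\<lambda>n. ip (sqrt_iterate D n x) y) \<longlonglongrightarrow> ip (Y x) y"
      by (rule bounded_linear.tendsto[OF bounded_linear_ip_left Y])
    moreover have "(\<lambda>n. ip (sqrt_iterate D n x) y) \<longlonglongrightarrow> ip x (Y y)"
      unfolding adjoint_pairD[OF iter] by (rule bounded_linear.tendsto[OF bounded_linear_ip Y])
    ultimately show "ip (Y x) y = ip x (Y y)" by (rule LIMSEQ_unique)
  qed
  define R where "R x = sqrt t *\<^sub>R (x - Y x)" for x
  have Rself: "adjoint_pair R R" unfolding R_def using Yself by (intro adjoint_pair_intros)
  have "norm_positive R"
  proof (rule norm_positiveI[OF Rself])
    show "norm (sqrt t *\<^sub>R x - R x) \<le> sqrt t * norm x" for x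
    proof -
      have "sqrt t *\<^sub>R x - R x = sqrt t *\<^sub>R Y x" by (simp add: R_def algebra_simps)
      then show ?thesis using nY[of x] t by simp
    qed
  qed (use t in simp)
  moreover have "R (R x) = T x" for x
  proof -
    have "R (R x) = t *\<^sub>R (x - 2 *\<^sub>R Y x + Y (Y x))"
      using t by (simp add: R_def adjoint_pair_arg[OF Yself] algebra_simps scaleR_2)
    then show ?thesis using t by (simp add: eqY D_def)
  qed
  moreover have "K (R x) = R (K x)" if K: "bounded_linear K" and KT: "\<And>x. K (T x) = T (K x)" for K x
  proof -
    have lin: "linear K" by (rule bounded_linear.linear[OF K])
    have KD: "K (D x) = D (K x)" for x
      by (simp add: D_def linear_diff[OF lin] linear_cmul[OF lin] KT)
    have "(\<lambda>n. K (sqrt_iterate D n x)) \<longlonglongrightarrow> K (Y x)"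
      by (rule bounded_linear.tendsto[OF K Y])
    moreover have "(\<lambda>n. K (sqrt_iterate D n x)) \<longlonglongrightarrow> Y (K x)"
      using Y[of "K x"] sqrt_iterate_commute[of K D, OF lin KD] by simp
    ultimately have "K (Y x) = Y (K x)" by (rule LIMSEQ_unique)
    then show ?thesis by (simp add: R_def linear_diff[OF lin] linear_cmul[OF lin])
  qed
  ultimately show ?thesis using that by blast
qed

text \<open>
  In the scalar case, \<open>C\<close> and \<open>R\<close> are the coordinates of a point \<open>C + i R\<close> on a circle, and \<open>C\<^sup>2 - R\<^sup>2\<close> is the
  real part of its square.  In general, \<open>U = C + i R\<close> and \<open>U\<^sup>* = C - i R\<close> multiply all norms by
  \<open>\<surd>s\<close>, and \<open>2 (C\<^sup>2 - R\<^sup>2) = U\<^sup>2 + U\<^sup>*\<^sup>2\<close>.  The bounds for norms of positive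
  operators below come from this identity.
\<close>

lemma norm_diff_squares_le:
  assumes C: "adjoint_pair C C" and R: "adjoint_pair R R"
    and comm: "\<And>x. C (R x) = R (C x)" and sum: "\<And>x. C (C x) + R (R x) = s *\<^sub>R x" and s: "s \<ge> 0"
  shows "norm (C (C x) - R (R x)) \<le> s * norm x"
proof -
  define U where "U \<sigma> x = C x + \<sigma> *\<^sub>C R x" for \<sigma> x
  have nU: "norm (U \<sigma> x) = sqrt s * norm x" if \<sigma>: "cnj \<sigma> = - \<sigma>" "\<sigma> * \<sigma> = - 1" for \<sigma> x
  proof -
    have "ip (U \<sigma> x) (U \<sigma> x) = ip x (C (C x)) + ip x (R (R x))"
      by (simp add: U_def ip_linear adjoint_pairD[OF C] adjoint_pairD[OF R] comm \<sigma>
          scaleC_add_right scaleC_diff_right scaleC_scaleC scaleC_minus_left)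
    also have "\<dots> = s *\<^sub>R ip x x" by (simp only: ip_add_right[symmetric] sum ip_scaleR_right)
    finally show ?thesis using s by (simp add: norm_ip real_sqrt_mult)
  qed
  have UU: "U \<sigma> (U \<sigma> x) = C (C x) + 2 *\<^sub>R (\<sigma> *\<^sub>C C (R x)) - R (R x)" if "\<sigma> * \<sigma> = - 1" for \<sigma>
    by (simp add: U_def adjoint_pair_arg[OF C] adjoint_pair_arg[OF R] comm scaleC_add_right
        scaleC_scaleC that scaleC_minus_left scaleR_2)
  have "norm (2 *\<^sub>R (C (C x) - R (R x))) = norm (U \<i> (U \<i> x) + U (- \<i>) (U (- \<i>) x))"
    by (subst (1 2) UU) (simp_all add: scaleC_minus_left scaleR_2)
  also have "\<dots> \<le> norm (U \<i> (U \<i> x)) + norm (U (- \<i>) (U (- \<i>) x))" by (rule norm_triangle_ineq)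
  also have "\<dots> = 2 * (s * norm x)"
    using s by (simp add: nU flip: mult.assoc)
  finally show ?thesis by simp
qed

text \<open>
  With \<open>c \<ge> \<parallel>R\<^sup>2\<parallel>\<close>, the operator \<open>c - R\<^sup>2\<close> has a root \<open>C\<close>, which commutes with \<open>R\<close>; so \<open>C\<^sup>2 + R\<^sup>2 = c\<close>, and
  \<open>\<parallel>c - 2 R\<^sup>2\<parallel> = \<parallel>C\<^sup>2 - R\<^sup>2\<parallel> \<le> c\<close>.
\<close>

lemma norm_positive_square:
  assumes R: "adjoint_pair R R"
  shows "norm_positive (\<lambda>x. R (R x))"
proof -
  obtain m where m: "m > 0" "\<And>x. norm (R x) \<le> m * norm x" using adjoint_pair_bound[OF R] by metis
  define c where "c = m * m"
  have RR: "adjoint_pair (\<lambda>x. R (R x)) (\<lambda>x. R (R x))" by (rule adjoint_pair_comp[OF R R])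
  have bound: "norm (R (R x)) \<le> c * norm x" for x
  proof -
    have "norm (R (R x)) \<le> m * (m * norm x)"
      using m(2)[of "R x"] mult_left_mono[OF m(2)[of x], of m] m(1) by linarith
    then show ?thesis by (simp add: c_def mult.assoc)
  qed
  have "norm_positive (\<lambda>x. c *\<^sub>R x - R (R x))"
    by (rule norm_positive_bound_minus[OF RR _ bound]) (simp add: c_def)
  then obtain C where C: "norm_positive C" "\<And>x. C (C x) = c *\<^sub>R x - R (R x)"
    and comm: "\<And>K x. bounded_linear K \<Longrightarrow> (\<And>x. K (c *\<^sub>R x - R (R x)) = c *\<^sub>R K x - R (R (K x)))
      \<Longrightarrow> K (C x) = C (K x)"
    by (rule norm_positive_root) blast
  have "R (C x) = C (R x)" for x
    by (rule comm[OF adjoint_pair_bounded_linear[OF R]]) (simp add: adjoint_pair_arg[OF R])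
  then have le: "norm (C (C x) - R (R x)) \<le> c * norm x" for x
    by (intro norm_diff_squares_le norm_positive_selfadjoint C(1) R)
      (simp_all add: C(2) c_def)
  show ?thesis
  proof (rule norm_positiveI[OF RR])
    show "norm ((c/2) *\<^sub>R x - R (R x)) \<le> c/2 * norm x" for x
    proof -
      have "(c/2) *\<^sub>R x - R (R x) = (1/2) *\<^sub>R (C (C x) - R (R x))"
        by (simp add: C(2) algebra_simps flip: scaleR_add_left)
      then show ?thesis using le[of x] by simp
    qed
  qed (simp add: c_def)
qed

text \<open>
  The roots \<open>C\<close> of \<open>t - D\<close> and \<open>R\<close> of \<open>t + D\<close> commute and satisfy \<open>C\<^sup>2 + R\<^sup>2 = 2 t\<close> and \<open>C\<^sup>2 - R\<^sup>2 = - 2 D\<close>.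
\<close>

lemma norm_le_of_norm_positive:
  assumes minus: "norm_positive (\<lambda>x. t *\<^sub>R x - D x)" and plus: "norm_positive (\<lambda>x. t *\<^sub>R x + D x)"
    and D: "adjoint_pair D D" and t: "t \<ge> 0"
  shows "norm (D x) \<le> t * norm x"
proof -
  obtain C where C: "norm_positive C" "\<And>x. C (C x) = t *\<^sub>R x - D x"
    and Ccomm: "\<And>K x. bounded_linear K \<Longrightarrow> (\<And>x. K (t *\<^sub>R x - D x) = t *\<^sub>R K x - D (K x))
      \<Longrightarrow> K (C x) = C (K x)"
    using minus by (rule norm_positive_root) blast
  obtain R where R: "norm_positive R" "\<And>x. R (R x) = t *\<^sub>R x + D x"
    and Rcomm: "\<And>K x. bounded_linear K \<Longrightarrow> (\<And>x. K (t *\<^sub>R x + D x) = t *\<^sub>R K x + D (K x))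
      \<Longrightarrow> K (R x) = R (K x)"
    using plus by (rule norm_positive_root) blast
  note Cs = norm_positive_selfadjoint[OF C(1)]
  note Rs = norm_positive_selfadjoint[OF R(1)]
  have DC: "D (C x) = C (D x)" for x
    by (rule Ccomm[OF adjoint_pair_bounded_linear[OF D]]) (simp add: adjoint_pair_arg[OF D])
  have "C (R x) = R (C x)" for x
    by (rule Rcomm[OF adjoint_pair_bounded_linear[OF Cs]]) (simp add: adjoint_pair_arg[OF Cs] DC)
  then have "norm (C (C x) - R (R x)) \<le> 2 * t * norm x"
    using t by (intro norm_diff_squares_le Cs Rs)
      (simp_all add: C(2) R(2) flip: scaleR_add_left)
  moreover have "C (C x) - R (R x) = - (2 *\<^sub>R D x)" by (simp add: C(2) R(2) scaleR_2)
  ultimately show ?thesis by simp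
qed

text \<open>
  Any bound \<open>c\<close> of the norm can serve as the constant in the norm condition: as \<open>c \<plusminus> (2 T - c)\<close> are
  both positive, \<open>\<parallel>2 T - c\<parallel> \<le> c\<close>, and \<open>c - T\<close> is the mean of \<open>c\<close> and \<open>c - 2 T\<close>.
\<close>

lemma norm_positive_norm:
  assumes T: "norm_positive T" and c: "c \<ge> 0" "\<And>x. norm (T x) \<le> c * norm x"
  shows "norm (c *\<^sub>R x - T x) \<le> c * norm x"
proof -
  note Ts = norm_positive_selfadjoint[OF T]
  have double: "2 *\<^sub>R (c *\<^sub>R x - T x) = c *\<^sub>R x - (2 *\<^sub>R T x - c *\<^sub>R x)" for x
    by (simp add: algebra_simps scaleR_2 flip: scaleR_add_left)
  have "norm (2 *\<^sub>R T x - c *\<^sub>R x) \<le> c * norm x"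
  proof (rule norm_le_of_norm_positive)
    show "norm_positive (\<lambda>x. c *\<^sub>R x - (2 *\<^sub>R T x - c *\<^sub>R x))"
      using norm_positive_scaleR[OF norm_positive_bound_minus[OF Ts c], of 2]
      by (simp only: double)
    show "norm_positive (\<lambda>x. c *\<^sub>R x + (2 *\<^sub>R T x - c *\<^sub>R x))"
      using norm_positive_scaleR[OF T, of 2] by simp
    show "adjoint_pair (\<lambda>x. 2 *\<^sub>R T x - c *\<^sub>R x) (\<lambda>x. 2 *\<^sub>R T x - c *\<^sub>R x)"
      using Ts by (intro adjoint_pair_intros)
  qed (rule c(1))
  moreover have "2 * norm (c *\<^sub>R x - T x) = norm (c *\<^sub>R x - (2 *\<^sub>R T x - c *\<^sub>R x))"
    unfolding double[symmetric] by simp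
  ultimately show ?thesis
    using norm_triangle_ineq4[of "c *\<^sub>R x" "2 *\<^sub>R T x - c *\<^sub>R x"] c(1) by simp
qed

text \<open>
  Both roots are compared with the root \<open>R0\<close> that is a limit of polynomials in \<open>R\<^sup>2\<close> and therefore commutes with any other root \<open>Q\<close>.
  For \<open>D = Q - R0\<close> one has \<open>(Q + R0) D = 0\<close>.  If \<open>a\<close> and \<open>b\<close> are roots of \<open>Q\<close> and \<open>R0\<close>, then the squares of
  the self-adjoint operators \<open>a D\<close> and \<open>b D\<close> have the sum \<open>(Q + R0) D\<^sup>2 = 0\<close>, so both vanish, whence
  \<open>Q D = 0 = R0 D\<close> and \<open>D\<^sup>2 = 0\<close>.
\<close>

lemma norm_positive_root_unique:
  assumes S: "norm_positive S" and R: "norm_positive R" and sq: "\<And>x. S (S x) = R (R x)"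
  shows "S = R"
proof -
  note Rs = norm_positive_selfadjoint[OF R]
  obtain R0 where R0: "norm_positive R0" "\<And>x. R0 (R0 x) = R (R x)"
    and R0comm: "\<And>K x. bounded_linear K \<Longrightarrow> (\<And>x. K (R (R x)) = R (R (K x))) \<Longrightarrow> K (R0 x) = R0 (K x)"
    using norm_positive_root[OF norm_positive_square[OF Rs]] by metis
  have main: "Q = R0" if Q: "norm_positive Q" and Qsq: "\<And>x. Q (Q x) = R (R x)" for Q
  proof
    fix x
    note Qs = norm_positive_selfadjoint[OF Q] and R0s = norm_positive_selfadjoint[OF R0(1)]
    have QR0: "Q (R0 x) = R0 (Q x)" for x
      by (rule R0comm[OF adjoint_pair_bounded_linear[OF Qs]]) (simp flip: Qsq)
    define D where "D x = Q x - R0 x" for x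
    have Ds: "adjoint_pair D D" unfolding D_def using Qs R0s by (intro adjoint_pair_intros)
    have QD: "Q (D x) = D (Q x)" and R0D: "R0 (D x) = D (R0 x)" for x
      by (simp_all add: D_def adjoint_pair_arg[OF Qs] adjoint_pair_arg[OF R0s] QR0)
    obtain a where a: "norm_positive a" "\<And>x. a (a x) = Q x"
      and acomm: "\<And>K x. bounded_linear K \<Longrightarrow> (\<And>x. K (Q x) = Q (K x)) \<Longrightarrow> K (a x) = a (K x)"
      using norm_positive_root[OF Q] by metis
    obtain b where b: "norm_positive b" "\<And>x. b (b x) = R0 x"
      and bcomm: "\<And>K x. bounded_linear K \<Longrightarrow> (\<And>x. K (R0 x) = R0 (K x)) \<Longrightarrow> K (b x) = b (K x)"
      using norm_positive_root[OF R0(1)] by metis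
    note as = norm_positive_selfadjoint[OF a(1)] and bs = norm_positive_selfadjoint[OF b(1)]
    have Da: "D (a x) = a (D x)" for x
      by (rule acomm[OF adjoint_pair_bounded_linear[OF Ds]]) (simp add: QD)
    have Db: "D (b x) = b (D x)" for x
      by (rule bcomm[OF adjoint_pair_bounded_linear[OF Ds]]) (simp add: R0D)
    have R0a: "R0 (a x) = a (R0 x)" for x
      by (rule acomm[OF adjoint_pair_bounded_linear[OF R0s]]) (simp add: QR0)
    have ab: "a (b x) = b (a x)" for x
      by (rule bcomm[OF adjoint_pair_bounded_linear[OF as]]) (simp add: R0a)
    define A where "A x = a (D x)" for x
    define B where "B x = b (D x)" for x
    have As: "adjoint_pair A A" using adjoint_pair_comp[OF as Ds] by (simp add: A_def[abs_def] Da)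
    have Bs: "adjoint_pair B B" using adjoint_pair_comp[OF bs Ds] by (simp add: B_def[abs_def] Db)
    have AA: "A (A x) = Q (D (D x))" and BB: "B (B x) = R0 (D (D x))" for x
      by (simp_all add: A_def B_def Da Db a(2) b(2))
    have zero: "Q (D x) + R0 (D x) = 0" for x
      by (simp add: D_def adjoint_pair_arg[OF Qs] adjoint_pair_arg[OF R0s] QR0 Qsq R0(2))
    have sum0: "A (A x) + B (B x) = 0 *\<^sub>R x" for x by (simp add: AA BB zero)
    have "norm (A (A x) - B (B x)) \<le> 0 * norm x" for x
      by (rule norm_diff_squares_le[OF As Bs _ sum0]) (simp_all add: A_def B_def Da Db ab)
    then have "A (A x) = B (B x)" for x by simp
    then have "2 *\<^sub>R A (A x) = 0" "2 *\<^sub>R B (B x) = 0" for x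
      using sum0[of x] by (simp_all add: scaleR_2)
    then have "A x = 0" "B x = 0" for x
      using selfadjoint_sq_eq_0[OF As] selfadjoint_sq_eq_0[OF Bs] by simp_all
    then have "Q (D x) = 0" "R0 (D x) = 0" for x
      using a(2)[of "D x"] b(2)[of "D x"]
      by (simp_all add: A_def B_def adjoint_pair_zero_arg[OF as] adjoint_pair_zero_arg[OF bs])
    then have "D (D x) = 0" by (simp add: D_def[of "D x"])
    then have "D x = 0" by (rule selfadjoint_sq_eq_0[OF Ds])
    then show "Q x = R0 x" by (simp add: D_def)
  qed
  show ?thesis using main[OF S sq] main[OF R] by simp
qed

text \<open>
  The numbers \<open>s \<ge> 0\<close> for which \<open>T + s\<close> is positive form a closed set, with a least element \<open>s\<close>.  If \<open>s > 0\<close>,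
  then \<open>S = T + s\<close> is positive and has an inverse \<open>K\<close>.  Take \<open>k \<ge> \<parallel>K\<parallel>\<close>.  Then \<open>S\<close> and \<open>k - K\<close> have commuting
  roots, so that their product \<open>k S - 1\<close> is a square and hence positive, and so is
  \<open>T + (s - 1/k)\<close>, in contradiction to the choice of \<open>s\<close>.
\<close>

lemma norm_positive_of_negative_resolvent:
  assumes T: "adjoint_pair T T"
    and inv: "\<And>s. s > 0 \<Longrightarrow> \<exists>K. \<forall>x. K (T x + s *\<^sub>R x) = x \<and> T (K x) + s *\<^sub>R K x = x"
  shows "norm_positive T"
proof -
  obtain m where m: "m > 0" "\<And>x. norm (T x) \<le> m * norm x" using adjoint_pair_bound[OF T] by metis
  \<comment> \<open>Positivity of \<open>T + s\<close> for \<open>0 \<le> s \<le> m\<close>, with the constant \<open>2 m \<ge> \<parallel>T + s\<parallel>\<close> for all these \<open>s\<close>; so the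
    set is visibly closed.\<close>
  define P where "P = {s. 0 \<le> s \<and> s \<le> m \<and> (\<forall>x. norm ((2*m) *\<^sub>R x - (T x + s *\<^sub>R x)) \<le> 2*m * norm x)}"
  have Tsself: "adjoint_pair (\<lambda>x. T x + s *\<^sub>R x) (\<lambda>x. T x + s *\<^sub>R x)" for s
    using T by (intro adjoint_pair_intros)
  have P_iff: "s \<in> P \<longleftrightarrow> norm_positive (\<lambda>x. T x + s *\<^sub>R x)" if s: "0 \<le> s" "s \<le> m" for s
  proof
    assume "s \<in> P"
    then show "norm_positive (\<lambda>x. T x + s *\<^sub>R x)"
      using m(1) by (intro norm_positiveI[OF Tsself, where t = "2*m"]) (auto simp: P_def)
  next
    assume np: "norm_positive (\<lambda>x. T x + s *\<^sub>R x)"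
    have "norm (T x + s *\<^sub>R x) \<le> 2 * m * norm x" for x
    proof -
      have "norm (s *\<^sub>R x) \<le> m * norm x" using s by (simp add: mult_right_mono)
      then show ?thesis
        using norm_triangle_ineq[of "T x" "s *\<^sub>R x"] m(2)[of x] by linarith
    qed
    then show "s \<in> P"
      using norm_positive_norm[OF np, of "2 * m"] s m(1) by (simp add: P_def)
  qed
  have "closed P"
  proof -
    have "P = {0..m} \<inter> (\<Inter>x. {s. norm ((2*m) *\<^sub>R x - (T x + s *\<^sub>R x)) \<le> 2*m * norm x})"
      by (auto simp: P_def)
    moreover have "closed {s. norm ((2*m) *\<^sub>R x - (T x + s *\<^sub>R x)) \<le> 2*m * norm x}" for x
      by (intro closed_Collect_le continuous_intros)
    ultimately show ?thesis by auto
  qed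
  have "m \<in> P"
    using norm_positive_bound_minus[OF adjoint_pair_scaleR[OF T, of "- 1"], of m] m P_iff[of m]
    by (simp add: add.commute)
  have bdd: "bdd_below P" by (rule bdd_belowI[of _ 0]) (simp add: P_def)
  define s where "s = Inf P"
  have "s \<in> P" unfolding s_def by (rule closed_contains_Inf) (use \<open>m \<in> P\<close> bdd \<open>closed P\<close> in auto)
  then have s: "0 \<le> s" "s \<le> m" by (auto simp: P_def)
  have "s = 0"
  proof (rule ccontr)
    assume "s \<noteq> 0"
    then have spos: "s > 0" using s by simp
    define S where "S x = T x + s *\<^sub>R x" for x
    have Sp: "norm_positive S" using \<open>s \<in> P\<close> P_iff[OF s] by (simp add: S_def[abs_def])
    note Ss = norm_positive_selfadjoint[OF Sp]
    obtain K where K: "\<And>x. K (S x) = x" "\<And>x. S (K x) = x" using inv[OF spos] by (auto simp: S_def)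
    have Ks: "adjoint_pair K K"
      unfolding adjoint_pair_def by (metis adjoint_pairD[OF Ss] K(2))
    obtain k0 where k0: "k0 > 0" "\<And>x. norm (K x) \<le> k0 * norm x" using adjoint_pair_bound[OF Ks] by metis
    \<comment> \<open>The summand \<open>1 / s\<close> ensures that \<open>s - 1 / k\<close> is still nonnegative.\<close>
    define k where "k = k0 + 1 / s"
    have k: "k > 0" "1 / k \<le> s" "\<And>x. norm (K x) \<le> k * norm x"
    proof -
      show "k > 0" using k0 spos by (simp add: k_def add_pos_pos)
      then show "1 / k \<le> s" using spos k0 by (simp add: k_def field_simps)
      show "norm (K x) \<le> k * norm x" for x
      proof -
        have "k0 * norm x \<le> k * norm x" using spos by (simp add: k_def mult_right_mono)
        then show ?thesis using k0(2)[of x] by linarith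
      qed
    qed
    have "norm_positive (\<lambda>x. k *\<^sub>R x - K x)"
      by (rule norm_positive_bound_minus[OF Ks _ k(3)]) (use k(1) in simp)
    then obtain Z where Z: "norm_positive Z" "\<And>x. Z (Z x) = k *\<^sub>R x - K x"
      and Zcomm: "\<And>L x. bounded_linear L \<Longrightarrow> (\<And>x. L (k *\<^sub>R x - K x) = k *\<^sub>R L x - K (L x))
        \<Longrightarrow> L (Z x) = Z (L x)"
      by (rule norm_positive_root) blast
    obtain R where R: "norm_positive R" "\<And>x. R (R x) = S x"
      and Rcomm: "\<And>L x. bounded_linear L \<Longrightarrow> (\<And>x. L (S x) = S (L x)) \<Longrightarrow> L (R x) = R (L x)"
      using norm_positive_root[OF Sp] by metis
    note Zs = norm_positive_selfadjoint[OF Z(1)] and Rs = norm_positive_selfadjoint[OF R(1)]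
    have KR: "K (R x) = R (K x)" for x
      by (rule Rcomm[OF adjoint_pair_bounded_linear[OF Ks]]) (simp add: K)
    have RZ: "R (Z x) = Z (R x)" for x
      by (rule Zcomm[OF adjoint_pair_bounded_linear[OF Rs]]) (simp add: adjoint_pair_arg[OF Rs] KR)
    define Q where "Q x = R (Z x)" for x
    have Qs: "adjoint_pair Q Q" using adjoint_pair_comp[OF Rs Zs] by (simp add: Q_def[abs_def] RZ)
    have "Q (Q x) = k *\<^sub>R S x - x" for x
      by (simp add: Q_def RZ Z(2)) (simp add: adjoint_pair_arg[OF Rs] R(2) KR[symmetric] K
          adjoint_pair_arg[OF Ks])
    then have "norm_positive (\<lambda>x. k *\<^sub>R S x - x)" using norm_positive_square[OF Qs] by simp
    from norm_positive_scaleR[OF this, of "1/k"] have "norm_positive (\<lambda>x. T x + (s - 1/k) *\<^sub>R x)"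
      using k(1) by (simp add: S_def algebra_simps)
    moreover have "0 \<le> s - 1/k" "s - 1/k \<le> m"
    proof -
      have "0 < 1/k" using k(1) by simp
      then show "s - 1/k \<le> m" using s by linarith
    qed (use k(2) in simp)
    ultimately have "s - 1/k \<in> P" using P_iff by blast
    then have "s \<le> s - 1/k" unfolding s_def using bdd by (rule cInf_lower)
    then show False using k(1) by simp
  qed
  then show ?thesis using \<open>s \<in> P\<close> P_iff[OF s] by simp
qed

section \<open>Positivity and spectra\<close>

lemma adjointable_iff: "adjointable ip T \<longleftrightarrow> (\<exists>R. adjoint_pair T R)"
  by (simp add: adjointable_def adjoint_pair_def)

lemma adj_eq: "adjoint_pair T R \<Longrightarrow> adj ip T = R"
  unfolding adj_def using adjoint_pair_unique by (intro the_equality) (auto simp: adjoint_pair_def)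

lemma adjoint_pair_adj: "adjointable ip T \<Longrightarrow> adjoint_pair T (adj ip T)"
  using adj_eq by (auto simp: adjointable_iff)

text \<open>
  The equation \<open>x = y + F x\<close> has a unique solution by Banach's fixed point theorem; the same
  for the adjoint \<open>F'\<close> provides the adjoint of the inverse.
\<close>

lemma id_minus_contraction_invertible:
  assumes F: "adjoint_pair F F'" and c: "0 \<le> c" "c < 1"
    and bF: "\<And>x. norm (F x) \<le> c * norm x" and bF': "\<And>x. norm (F' x) \<le> c * norm x"
  obtains G where "adjointable ip G" "\<And>y. G y - F (G y) = y" "\<And>x. G (x - F x) = x"
proof -
  have solve: "\<exists>!x. y + Q x = x"
    if Q: "adjoint_pair Q Q'" and bQ: "\<And>x. norm (Q x) \<le> c * norm x" for Q Q' y
  proof (rule banach_fix_type[OF c], intro allI)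
    fix a b
    have "(y + Q a) - (y + Q b) = Q (a - b)" by (simp add: adjoint_pair_arg[OF Q])
    then show "dist (y + Q a) (y + Q b) \<le> c * dist a b" using bQ[of "a - b"] by (simp add: dist_norm)
  qed
  define G where "G y = (THE x. y + F x = x)" for y
  define G' where "G' y = (THE x. y + F' x = x)" for y
  have G: "y + F (G y) = G y" for y unfolding G_def by (rule theI'[OF solve[OF F bF]])
  have G': "y + F' (G' y) = G' y" for y
    unfolding G'_def by (rule theI'[OF solve[OF adjoint_pair_sym[OF F] bF']])
  have Geq: "G y - F (G y) = y" and G'eq: "G' y - F' (G' y) = y" for y
    using G[of y] G'[of y] by (simp_all add: diff_eq_eq)
  have "adjoint_pair G G'"
    unfolding adjoint_pair_def
  proof (intro allI)
    fix x y
    have "ip (G x) y = ip (G x) (G' y - F' (G' y))" by (simp only: G'eq)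
    also have "\<dots> = ip (G x - F (G x)) (G' y)" by (simp add: ip_linear adjoint_pairD[OF F])
    finally show "ip (G x) y = ip x (G' y)" by (simp only: Geq)
  qed
  moreover have "G (x - F x) = x" for x
    unfolding G_def by (rule the1_equality[OF solve[OF F bF]]) simp
  ultimately show ?thesis using that Geq by (auto simp: adjointable_iff)
qed

text \<open>
  \<open>T - z = (w - z) (1 - F)\<close>, where \<open>F = (T - w) / (z - w)\<close> has norm less than \<open>1\<close>.
\<close>

lemma not_in_op_spectrum:
  assumes T: "adjoint_pair T T" and c: "0 \<le> c" "c < cmod (w - z)"
    and b: "\<And>x. norm (T x - w *\<^sub>C x) \<le> c * norm x" "\<And>x. norm (T x - cnj w *\<^sub>C x) \<le> c * norm x"
  shows "z \<notin> op_spectrum ip T"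
proof -
  define d where "d = z - w"
  have d: "d \<noteq> 0" "c < cmod d" using c by (auto simp: d_def norm_minus_commute)
  define F where "F x = (1 / d) *\<^sub>C (T x - w *\<^sub>C x)" for x
  define F' where "F' x = cnj (1 / d) *\<^sub>C (T x - cnj w *\<^sub>C x)" for x
  have F: "adjoint_pair F F'"
    unfolding F_def F'_def using T by (intro adjoint_pair_intros)
  have "norm (F x) \<le> c / cmod d * norm x" "norm (F' x) \<le> c / cmod d * norm x" for x
    using b[of x] d by (simp_all add: F_def F'_def norm_scaleC norm_divide divide_right_mono)
  moreover have "0 \<le> c / cmod d" "c / cmod d < 1" using c d by auto
  ultimately obtain G where G: "adjointable ip G" "\<And>y. G y - F (G y) = y" "\<And>x. G (x - F x) = x"
    using id_minus_contraction_invertible[OF F] by metis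
  obtain G' where "adjoint_pair G G'" using G(1) by (auto simp: adjointable_iff)
  note Gl = adjoint_pair_cscale[OF this]
  have key: "T x - z *\<^sub>C x = (- d) *\<^sub>C (x - F x)" for x
    using d by (simp add: F_def scaleC_diff_right scaleC_scaleC scaleC_minus_left)
      (simp add: d_def scaleC_diff_left)
  define R where "R x = (- 1 / d) *\<^sub>C G x" for x
  have RG: "R x = G ((- 1 / d) *\<^sub>C x)" for x by (simp add: R_def Gl)
  have "adjointable ip R"
    unfolding R_def[abs_def] adjointable_iff using \<open>adjoint_pair G G'\<close> adjoint_pair_scaleC by blast
  moreover have "(\<lambda>x. T x - z *\<^sub>C x) \<circ> R = id"
    unfolding o_def key RG G(2) using d by (auto simp: scaleC_scaleC)
  moreover have "R \<circ> (\<lambda>x. T x - z *\<^sub>C x) = id"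
    unfolding o_def key RG using d by (auto simp: scaleC_scaleC G(3))
  ultimately show ?thesis by (auto simp: op_spectrum_def)
qed

text \<open>
  Forward, the resolvents at negative numbers make \<open>T + s\<close> invertible for all \<open>s > 0\<close>.  Conversely, every \<open>z\<close>
  outside the half-line lies too far from a suitable centre \<open>w\<close>: for \<open>z < 0\<close> this is \<open>w = t\<close>, as
  \<open>\<parallel>T - t\<parallel> \<le> t < t - z\<close>; for nonreal \<open>z\<close> it is a large multiple \<open>w = - i \<mu>\<close> of the imaginary unit, as
  \<open>\<parallel>T + i \<mu>\<parallel>\<^sup>2 \<le> \<parallel>T\<parallel>\<^sup>2 + \<mu>\<^sup>2\<close> while \<open>|z + i \<mu>|\<^sup>2\<close> contains the term \<open>2 \<mu> Im z\<close>.
\<close>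

lemma op_positive_iff: "op_positive ip T \<longleftrightarrow> norm_positive T"
proof
  assume pos: "op_positive ip T"
  then have T: "adjoint_pair T T" using adjoint_pair_adj[of T] by (simp add: op_positive_def)
  show "norm_positive T"
  proof (rule norm_positive_of_negative_resolvent[OF T])
    fix s :: real assume s: "s > 0"
    then have "- complex_of_real s \<notin> \<real>\<^sub>\<ge>\<^sub>0"
      by (auto simp: nonneg_Reals_of_real_iff simp flip: of_real_minus)
    then have "- complex_of_real s \<notin> op_spectrum ip T" using pos by (auto simp: op_positive_def)
    then obtain R where "(\<lambda>x. T x - (- complex_of_real s) *\<^sub>C x) \<circ> R = id"
      "R \<circ> (\<lambda>x. T x - (- complex_of_real s) *\<^sub>C x) = id"
      unfolding op_spectrum_def by blast
    then show "\<exists>K. \<forall>x. K (T x + s *\<^sub>R x) = x \<and> T (K x) + s *\<^sub>R K x = x"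
      by (auto simp: fun_eq_iff scaleC_minus_left scaleR_scaleC)
  qed
next
  assume np: "norm_positive T"
  then have T: "adjoint_pair T T" by (rule norm_positive_selfadjoint)
  obtain t where t: "t \<ge> 0" "\<And>x. norm (t *\<^sub>R x - T x) \<le> t * norm x"
    using np by (auto simp: norm_positive_def)
  have "z \<notin> op_spectrum ip T" if z: "z \<notin> \<real>\<^sub>\<ge>\<^sub>0" for z
  proof (cases "Im z = 0")
    case True
    then have "Re z < 0" using z by (auto simp: complex_nonneg_Reals_iff)
    then have "t < cmod (complex_of_real t - z)"
      using t(1) complex_Re_le_cmod[of "complex_of_real t - z"] by simp
    then show ?thesis
      using t by (intro not_in_op_spectrum[OF T, where c = t and w = "complex_of_real t"])
        (simp_all add: norm_minus_commute[of "T _"] flip: scaleR_scaleC)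
  next
    case False
    obtain m where m: "m > 0" "\<And>x. norm (T x) \<le> m * norm x" using adjoint_pair_bound[OF T] by metis
    \<comment> \<open>Chosen such that \<open>2 \<mu> Im z = m\<^sup>2 + 1\<close>, which exceeds \<open>m\<^sup>2 \<ge> \<parallel>T\<parallel>\<^sup>2\<close>.\<close>
    define \<mu> where "\<mu> = (m\<^sup>2 + 1) / (2 * Im z)"
    define c where "c = sqrt (m\<^sup>2 + \<mu>\<^sup>2)"
    have bound: "norm (T x - w *\<^sub>C x) \<le> c * norm x" if w: "w = \<i> * complex_of_real \<nu>" "\<nu>\<^sup>2 = \<mu>\<^sup>2" for w \<nu> x
    proof -
      have "cnj w = - w" "w * w = - complex_of_real (\<mu>\<^sup>2)"
        using w by (simp_all add: power2_eq_square algebra_simps flip: of_real_mult)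
      then have "ip (T x - w *\<^sub>C x) (T x - w *\<^sub>C x) = ip (T x) (T x) + \<mu>\<^sup>2 *\<^sub>R ip x x"
        by (simp add: ip_linear adjoint_pairD[OF T] scaleC_minus_left scaleC_scaleC scaleR_scaleC
            scaleC_diff_right scaleC_add_right)
      then have "(norm (T x - w *\<^sub>C x))\<^sup>2 \<le> (norm (T x))\<^sup>2 + \<mu>\<^sup>2 * (norm x)\<^sup>2"
        using norm_triangle_ineq[of "ip (T x) (T x)" "\<mu>\<^sup>2 *\<^sub>R ip x x"] by (simp add: power2_norm_ip)
      also have "\<dots> \<le> (m * norm x)\<^sup>2 + \<mu>\<^sup>2 * (norm x)\<^sup>2"
        using m(2)[of x] by (simp add: power_mono)
      also have "\<dots> = (c * norm x)\<^sup>2"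
        by (simp add: c_def power_mult_distrib algebra_simps)
      finally show ?thesis by (rule power2_le_imp_le) (simp add: c_def)
    qed
    have "m\<^sup>2 + \<mu>\<^sup>2 < (Re z)\<^sup>2 + (Im z + \<mu>)\<^sup>2"
    proof -
      have "2 * Im z * \<mu> = m\<^sup>2 + 1" using False by (simp add: \<mu>_def)
      then have "(Re z)\<^sup>2 + (Im z + \<mu>)\<^sup>2 = (Re z)\<^sup>2 + (Im z)\<^sup>2 + m\<^sup>2 + 1 + \<mu>\<^sup>2"
        by (simp add: power2_sum algebra_simps)
      then show ?thesis using zero_le_power2[of "Re z"] zero_le_power2[of "Im z"] by linarith
    qed
    then have lt: "c < cmod (\<i> * complex_of_real (- \<mu>) - z)"
      by (simp add: c_def cmod_def power2_commute[of "- \<mu>"] power2_eq_square algebra_simps)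
    show ?thesis
      by (rule not_in_op_spectrum[OF T _ lt bound[of _ "- \<mu>"] bound[of _ "\<mu>"]])
        (simp_all add: c_def)
  qed
  then show "op_positive ip T"
    using T adj_eq[OF T] by (auto simp: op_positive_def adjointable_iff)
qed

end

section \<open>Positive elements of a C*-algebra\<close>

text \<open>
  The algebra as a module over itself.  Here the Cauchy-Schwarz inequality is just
  submultiplicativity of the norm.
\<close>

lemma cstar_valued_ip_algebra: "cstar_valued_ip (\<lambda>a b :: 'a::cstar_algebra. star a * b)"
proof
  fix a b c :: 'a and z :: complex
  show "star a * (b + c) = star a * b + star a * c" by (simp add: distrib_left)
  show "star a * (z *\<^sub>C b) = z *\<^sub>C (star a * b)" by (rule mult_scaleC_right)
  show "star (star a * b) = star b * a" by (simp add: star_mult star_star)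
  show "norm a = sqrt (norm (star a * a))" by (simp add: cstar_identity)
  show "norm (star a * b) \<le> norm a * norm b" using norm_mult_ineq[of "star a" b] by (simp add: norm_star)
qed

text \<open>
  An inverse \<open>k + c 1\<close> of \<open>a + s 1\<close> in the unitization acts by multiplication on the algebra, and there
  inverts the left multiplication by \<open>a + s 1\<close>.
\<close>

lemma cstar_positive_norm_positive:
  fixes a :: "'a::cstar_algebra"
  assumes "cstar_positive a"
  shows "cstar_valued_ip.norm_positive (\<lambda>a b. star a * b) (\<lambda>b. a * b)"
proof -
  interpret L: cstar_valued_ip "\<lambda>a b :: 'a. star a * b" by (rule cstar_valued_ip_algebra)
  have a: "star a = a" "cstar_spectrum a \<subseteq> \<real>\<^sub>\<ge>\<^sub>0" using assms by (auto simp: cstar_positive_def)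
  show ?thesis
  proof (rule L.norm_positive_of_negative_resolvent)
    show "L.adjoint_pair (\<lambda>b. a * b) (\<lambda>b. a * b)"
      by (simp add: L.adjoint_pair_def star_mult a mult.assoc)
    fix s :: real assume s: "s > 0"
    then have "- complex_of_real s \<notin> \<real>\<^sub>\<ge>\<^sub>0" by (auto simp: nonneg_Reals_of_real_iff simp flip: of_real_minus)
    then have "- complex_of_real s \<notin> cstar_spectrum a" using a(2) by blast
    then obtain u where u: "unitization_mult (a, complex_of_real s) u = (0, 1)"
        "unitization_mult u (a, complex_of_real s) = (0, 1)"
      by (auto simp: cstar_spectrum_def)
    obtain k c where uk: "u = (k, c)" by (cases u)
    have r: "a * k + s *\<^sub>R k + c *\<^sub>C a = 0" "complex_of_real s * c = 1"
      and l: "k * a + c *\<^sub>C a + s *\<^sub>R k = 0"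
      using u by (simp_all add: uk unitization_mult_def scaleR_scaleC)
    define K where "K b = k * b + c *\<^sub>C b" for b
    have cs: "c *\<^sub>C s *\<^sub>R b = b" "s *\<^sub>R c *\<^sub>C b = b" for b :: 'a
      using r(2) by (simp_all add: scaleR_scaleC scaleC_scaleC mult.commute)
    have "K (a * b + s *\<^sub>R b) = (k * a + c *\<^sub>C a + s *\<^sub>R k) * b + c *\<^sub>C s *\<^sub>R b" for b
      by (simp add: K_def distrib_left distrib_right mult.assoc mult_scaleC_left scaleC_add_right)
    moreover have "a * K b + s *\<^sub>R K b = (a * k + s *\<^sub>R k + c *\<^sub>C a) * b + s *\<^sub>R c *\<^sub>C b" for b
      by (simp add: K_def distrib_left distrib_right mult.assoc mult_scaleC_left mult_scaleC_right
          scaleR_add_right)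
    ultimately show "\<exists>K. \<forall>b. K (a * b + s *\<^sub>R b) = b \<and> a * K b + s *\<^sub>R K b = b"
      by (metis r(1) l cs add_0 mult_zero_left)
  qed
qed

text \<open>
  \<open>t - (p - q) = (t - p) + q\<close> and \<open>t + (p - q) = (t - q) + p\<close> are sums of positive operators.
\<close>

lemma norm_diff_le_of_cstar_positive:
  fixes p q :: "'a::cstar_algebra"
  assumes p: "cstar_positive p" and q: "cstar_positive q" and t: "norm p \<le> t" "norm q \<le> t"
  shows "norm (p - q) \<le> t"
proof -
  interpret L: cstar_valued_ip "\<lambda>a b :: 'a. star a * b" by (rule cstar_valued_ip_algebra)
  have t0: "0 \<le> t" using t(1) norm_ge_zero order_trans by blast
  have upper: "L.norm_positive (\<lambda>b. t *\<^sub>R b - a * b)" if "cstar_positive a" "norm a \<le> t" for a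
  proof (rule L.norm_positive_bound_minus[OF _ t0])
    show "L.adjoint_pair (\<lambda>b. a * b) (\<lambda>b. a * b)"
      using that(1) by (rule L.norm_positive_selfadjoint[OF cstar_positive_norm_positive])
    show "norm (a * b) \<le> t * norm b" for b
      using norm_mult_ineq[of a b] mult_right_mono[OF that(2), of "norm b"] by simp
  qed
  have sa: "star (p - q) = p - q"
    using p q star_add[of "p - q" q] by (auto simp: cstar_positive_def algebra_simps)
  have "norm ((p - q) * b) \<le> t * norm b" for b
  proof (rule L.norm_le_of_norm_positive)
    show "L.norm_positive (\<lambda>b. t *\<^sub>R b - (p - q) * b)"
      using L.norm_positive_add[OF upper[OF p t(1)] cstar_positive_norm_positive[OF q]]
      by (simp add: algebra_simps)
    show "L.norm_positive (\<lambda>b. t *\<^sub>R b + (p - q) * b)"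
      using L.norm_positive_add[OF upper[OF q t(2)] cstar_positive_norm_positive[OF p]]
      by (simp add: algebra_simps)
    show "L.adjoint_pair (\<lambda>b. (p - q) * b) (\<lambda>b. (p - q) * b)"
      by (simp add: L.adjoint_pair_def star_mult sa mult.assoc)
  qed (rule t0)
  from this[of "p - q"] have "norm (p - q) * norm (p - q) \<le> t * norm (p - q)"
    using cstar_identity[of "p - q"] by (simp add: sa power2_eq_square)
  then show ?thesis using t0 by (cases "p = q") auto
qed

text \<open>
  \<open>t - p = (t - (p + q)) + q\<close> is a sum of positive operators when \<open>t = \<parallel>p + q\<parallel>\<close>.
\<close>

lemma norm_le_norm_add_cstar_positive:
  fixes p q :: "'a::cstar_algebra"
  assumes p: "cstar_positive p" and q: "cstar_positive q"
  shows "norm p \<le> norm (p + q)"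
proof -
  interpret L: cstar_valued_ip "\<lambda>a b :: 'a. star a * b" by (rule cstar_valued_ip_algebra)
  define t where "t = norm (p + q)"
  note Lp = cstar_positive_norm_positive[OF p] and Lq = cstar_positive_norm_positive[OF q]
  have "L.norm_positive (\<lambda>b. t *\<^sub>R b - (p + q) * b)"
  proof (rule L.norm_positive_bound_minus)
    show "L.adjoint_pair (\<lambda>b. (p + q) * b) (\<lambda>b. (p + q) * b)"
      using L.norm_positive_selfadjoint[OF L.norm_positive_add[OF Lp Lq]]
      by (simp add: distrib_right)
  qed (simp_all add: t_def norm_mult_ineq)
  from L.norm_positive_add[OF this Lq]
  have minus: "L.norm_positive (\<lambda>b. t *\<^sub>R b - p * b)" by (simp add: algebra_simps)
  have "L.norm_positive (\<lambda>b. t *\<^sub>R b)"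
    by (rule L.norm_positiveI[where t = t])
      (simp_all add: t_def L.adjoint_pair_def star_scaleR)
  from L.norm_positive_add[OF this Lp]
  have plus: "L.norm_positive (\<lambda>b. t *\<^sub>R b + p * b)" .
  have "norm (p * b) \<le> t * norm b" for b
    by (rule L.norm_le_of_norm_positive[OF minus plus L.norm_positive_selfadjoint[OF Lp]])
      (simp add: t_def)
  from this[of p] have "norm p * norm p \<le> t * norm p"
    using cstar_identity[of p] p by (simp add: cstar_positive_def power2_eq_square)
  then show ?thesis by (cases "p = 0") (auto simp: t_def)
qed

section \<open>Absolute values\<close>

text \<open>
  Monotonicity of the norm is the only consequence of the positivity of \<open>\<langle>x, x\<rangle>\<close> that the theory of
  absolute values and polar decompositions uses.
\<close>

locale cstar_module_ip = cstar_valued_ip ip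
  for ip :: "'h::complex_banach \<Rightarrow> 'h \<Rightarrow> 'a::cstar_algebra" +
  assumes norm_ip_le_add: "norm (ip x x) \<le> norm (ip x x + ip y y)"
begin

lemma ip_add_eq_0D: "ip x x + ip y y = 0 \<Longrightarrow> x = 0"
  using norm_ip_le_add[of x y] by (simp add: ip_self_eq_0)

text \<open>
  With \<open>V = T\<^sup>* T\<close> and \<open>t \<ge> \<parallel>T T\<^sup>*\<parallel>\<close> one has
  \<open>t\<^sup>2 \<langle>x, x\<rangle> - \<langle>(t - V) x, (t - V) x\<rangle> = \<langle>T x, (2 t - T T\<^sup>*) T x\<rangle>\<close>.  The operator \<open>2 t - T T\<^sup>*\<close> is positive merely
  because \<open>\<parallel>T T\<^sup>*\<parallel> \<le> 2 t\<close>.  With its root \<open>Z\<close>, the right-hand side is \<open>\<langle>Z T x, Z T x\<rangle>\<close>, and monotonicity of the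
  norm gives \<open>\<parallel>t - V\<parallel> \<le> t\<close>.
\<close>

lemma norm_positive_adjoint_comp:
  assumes T: "adjoint_pair T T'"
  shows "norm_positive (\<lambda>x. T' (T x))"
proof -
  note T' = adjoint_pair_sym[OF T]
  obtain m where m: "m > 0" "\<And>x. norm (T x) \<le> m * norm x" using adjoint_pair_bound[OF T] by metis
  obtain m' where m': "m' > 0" "\<And>x. norm (T' x) \<le> m' * norm x" using adjoint_pair_bound[OF T'] by metis
  define t where "t = m * m'"
  have t: "t \<ge> 0" using m m' by (simp add: t_def)
  have TT': "adjoint_pair (\<lambda>x. T (T' x)) (\<lambda>x. T (T' x))" by (rule adjoint_pair_comp[OF T T'])
  have "norm (T (T' x)) \<le> 2 * t * norm x" for x
  proof -
    have "norm (T (T' x)) \<le> m * (m' * norm x)"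
      using m(2)[of "T' x"] mult_left_mono[OF m'(2)[of x], of m] m(1) by linarith
    moreover have "0 \<le> t * norm x" using t by simp
    ultimately show ?thesis by (simp add: t_def mult.assoc)
  qed
  then have "norm_positive (\<lambda>x. (2 * t) *\<^sub>R x - T (T' x))"
    using t by (intro norm_positive_bound_minus[OF TT']) auto
  then obtain Z where Z: "norm_positive Z" "\<And>x. Z (Z x) = (2 * t) *\<^sub>R x - T (T' x)"
    by (rule norm_positive_root) blast
  note Zs = norm_positive_selfadjoint[OF Z(1)]
  show ?thesis
  proof (rule norm_positiveI[OF adjoint_pair_comp[OF T' T] t])
    fix x
    have "ip (Z (T x)) (Z (T x)) = (2 * t) *\<^sub>R ip x (T' (T x)) - ip (T' (T x)) (T' (T x))"
      by (simp add: adjoint_pairD[OF Zs] Z(2) ip_linear adjoint_pairD[OF T] adjoint_pairD[OF T']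
          adjoint_pair_arg[OF T'])
    moreover have "ip (t *\<^sub>R x - T' (T x)) (t *\<^sub>R x - T' (T x)) =
        t\<^sup>2 *\<^sub>R ip x x - (2 * t) *\<^sub>R ip x (T' (T x)) + ip (T' (T x)) (T' (T x))"
      by (simp add: ip_linear adjoint_pairD[OF T'] adjoint_pairD[OF T] power2_eq_square
          algebra_simps scaleR_2 flip: scaleR_scaleR)
    ultimately have "ip (t *\<^sub>R x - T' (T x)) (t *\<^sub>R x - T' (T x)) + ip (Z (T x)) (Z (T x)) = t\<^sup>2 *\<^sub>R ip x x"
      by simp
    then have "(norm (t *\<^sub>R x - T' (T x)))\<^sup>2 \<le> (t * norm x)\<^sup>2"
      using norm_ip_le_add[of "t *\<^sub>R x - T' (T x)" "Z (T x)"]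
      by (simp add: power2_norm_ip power_mult_distrib)
    then show "norm (t *\<^sub>R x - T' (T x)) \<le> t * norm x"
      by (rule power2_le_imp_le) (use t in simp)
  qed
qed

lemma op_abs_eqI:
  assumes T: "adjoint_pair T T'" and N: "norm_positive N" "\<And>x. N (N x) = T' (T x)"
  shows "op_abs ip T = N"
  unfolding op_abs_def op_sqrt_def adj_eq[OF T]
proof (rule the_equality)
  show "op_positive ip N \<and> N \<circ> N = T' \<circ> T" using N by (auto simp: op_positive_iff)
  fix R assume R: "op_positive ip R \<and> R \<circ> R = T' \<circ> T"
  then have "R (R x) = N (N x)" for x using N(2) by (metis comp_apply)
  then show "R = N" using R N(1) norm_positive_root_unique by (simp add: op_positive_iff)
qed

lemma op_abs:
  assumes T: "adjoint_pair T T'"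
  shows "norm_positive (op_abs ip T)" "op_abs ip T (op_abs ip T x) = T' (T x)"
proof -
  obtain N where N: "norm_positive N" "\<And>x. N (N x) = T' (T x)"
    using norm_positive_root[OF norm_positive_adjoint_comp[OF T]] by metis
  then show "norm_positive (op_abs ip T)" "op_abs ip T (op_abs ip T x) = T' (T x)"
    using op_abs_eqI[OF T N] by simp_all
qed

section \<open>Polar decompositions\<close>

lemma adjoint_pair_image_closure:
  assumes "adjoint_pair S R" "x \<in> closure M"
  shows "S x \<in> closure (S ` M)"
  using closure_bounded_linear_image_subset[OF adjoint_pair_bounded_linear[OF assms(1)], of M] assms(2)
  by blast

lemma selfadjoint_commute_adjoint:
  assumes "adjoint_pair N N" "adjoint_pair Q Q" "\<And>x. N (Q x) = N x"
  shows "Q (N x) = N x"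
proof -
  have "adjoint_pair (\<lambda>x. N (Q x)) (\<lambda>x. Q (N x))"
    using assms(1,2) by (rule adjoint_pair_comp)
  then have "adjoint_pair N (\<lambda>x. Q (N x))" by (simp add: assms(3))
  from adjoint_pair_unique[OF assms(1) this] show ?thesis by (rule fun_cong[symmetric])
qed

text \<open>
  The difference of two candidates is orthogonal to both of them, hence to itself.
\<close>

lemma proj_onto_eqI:
  assumes p: "p \<in> M" "x - p \<in> orth_compl ip M"
  shows "proj_onto ip M x = p"
  unfolding proj_onto_def
proof (rule the_equality)
  fix m assume m: "m \<in> M \<and> x - m \<in> orth_compl ip M"
  have "ip (m - p) y = 0" if "y \<in> M" for y
  proof -
    have "ip (x - m) y = 0" "ip (x - p) y = 0" using m p that by (auto simp: orth_compl_def)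
    then show ?thesis by (simp add: ip_linear)
  qed
  then have "ip (m - p) (m - p) = 0" using m p by (simp only: ip_diff_right) simp
  then show "m = p" using ip_self_eq_0 by fastforce
qed (use p in simp)

text \<open>
  A description of the polar decomposition \<open>Y = W N\<close> by equations, in which the closed range of \<open>Y\<^sup>*\<close>, its
  complement and the projection onto it do not appear; \<open>W'\<close> is meant to be the adjoint of \<open>W\<close>.
\<close>

definition polar_factors :: "('h \<Rightarrow> 'h) \<Rightarrow> ('h \<Rightarrow> 'h) \<Rightarrow> ('h \<Rightarrow> 'h) \<Rightarrow> ('h \<Rightarrow> 'h) \<Rightarrow> bool" where
  "polar_factors Y W W' N \<longleftrightarrow> norm_positive N \<and> (\<forall>x. Y x = W (N x)) \<and> (\<forall>x. W' (Y x) = N x) \<and>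
     (\<forall>x. W' (W x) \<in> closure (range N))"

lemma polar_factorsD:
  assumes "polar_factors Y W W' N"
  shows "norm_positive N" "Y x = W (N x)" "W' (Y x) = N x" "W' (W x) \<in> closure (range N)"
  using assms unfolding polar_factors_def by blast+

text \<open>
  Taking adjoints in \<open>Y = W N\<close> and \<open>W\<^sup>* Y = N\<close> gives \<open>Y\<^sup>* = N W\<^sup>*\<close> and \<open>Y\<^sup>* W = N\<close>.  In particular the ranges of
  \<open>Y\<^sup>*\<close> and \<open>N\<close> coincide even before closures are taken.
\<close>

lemma modulus_adjoint:
  assumes W: "adjoint_pair W W'" and Y: "adjoint_pair Y Y'" and N: "adjoint_pair N N"
    and YWN: "\<And>x. Y x = W (N x)" and WYN: "\<And>x. W' (Y x) = N x"
  shows "Y' x = N (W' x)" "Y' (W x) = N x" "range Y' = range N" "N (N x) = Y' (Y x)"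
proof -
  have "adjoint_pair Y (\<lambda>x. N (W' x))" using adjoint_pair_comp[OF W N] by (simp flip: YWN)
  from adjoint_pair_unique[OF Y this] have 1: "Y' x = N (W' x)" for x by simp
  have "adjoint_pair N (\<lambda>x. Y' (W x))"
    using adjoint_pair_comp[OF adjoint_pair_sym[OF W] Y] by (simp add: WYN)
  from adjoint_pair_unique[OF N this] have 2: "Y' (W x) = N x" for x by (rule fun_cong[symmetric])
  show "Y' x = N (W' x)" "Y' (W x) = N x" by (fact 1, fact 2)
  show "range Y' = range N"
  proof
    show "range Y' \<subseteq> range N" by (auto simp: 1)
    show "range N \<subseteq> range Y'" by (metis 2 image_subsetI rangeI)
  qed
  show "N (N x) = Y' (Y x)" by (simp add: 1 WYN)
qed

lemma polar_factors_fixed: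
  assumes W: "adjoint_pair W W'" and pf: "polar_factors Y W W' N" and z: "z \<in> closure (range N)"
  shows "W' (W z) = z"
proof -
  define f where "f x = W' (W x) - x" for x
  have f: "adjoint_pair f f"
    unfolding f_def by (intro adjoint_pair_diff adjoint_pair_id adjoint_pair_comp[OF adjoint_pair_sym[OF W] W])
  have "f ` range N \<subseteq> {0}"
    using polar_factorsD(2,3)[OF pf] by (auto simp: f_def simp flip: polar_factorsD(2)[OF pf])
  then have "closure (f ` range N) \<subseteq> {0}" by (simp add: closure_minimal)
  then have "f z = 0" using adjoint_pair_image_closure[OF f z] by blast
  then show ?thesis by (simp add: f_def)
qed

text \<open>
  For \<open>u = (W - W W\<^sup>* W) x\<close> one has \<open>W\<^sup>* u = 0\<close>, while \<open>u\<close> is in the range of \<open>W\<close>; so \<open>\<langle>u, u\<rangle> = 0\<close>.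
\<close>

lemma idempotent_partial_isometry:
  assumes W: "adjoint_pair W W'" and idem: "\<And>x. W' (W (W' (W x))) = W' (W x)"
  shows "W (W' (W x)) = W x" "W' (W (W' x)) = W' x"
proof -
  note W' = adjoint_pair_sym[OF W]
  have 1: "W (W' (W x)) = W x" for x
  proof -
    define u where "u = W x - W (W' (W x))"
    have "W' u = 0" by (simp add: u_def adjoint_pair_arg[OF W'] idem)
    then have "ip u (W z) = 0" for z by (simp add: adjoint_pairD[OF W', symmetric])
    moreover have "u = W (x - W' (W x))" by (simp add: u_def adjoint_pair_arg[OF W])
    ultimately have "ip u u = 0" by metis
    then have "u = 0" by (rule ip_self_eq_0)
    then show ?thesis by (simp add: u_def)
  qed
  have "adjoint_pair W (\<lambda>x. W' (W (W' x)))"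
    using adjoint_pair_comp[OF W adjoint_pair_comp[OF W' W]] by (simp add: 1)
  from adjoint_pair_unique[OF W this] show "W' (W (W' x)) = W' x" by (rule fun_cong[symmetric])
  show "W (W' (W x)) = W x" by (rule 1)
qed

lemma polar_factors_partial_isometry:
  assumes W: "adjoint_pair W W'" and pf: "polar_factors Y W W' N"
  shows "W (W' (W x)) = W x" "W' (W (W' x)) = W' x"
proof -
  have "W' (W (W' (W x))) = W' (W x)" for x
    by (intro polar_factors_fixed[OF W pf] polar_factorsD(4)[OF pf])
  from idempotent_partial_isometry[OF W this]
  show "W (W' (W x)) = W x" "W' (W (W' x)) = W' x" by simp_all
qed

text \<open>
  \<open>W\<^sup>* W\<close> is the identity on the range of \<open>N\<close>, hence on its closure \<open>M\<close>, and it maps into \<open>M\<close>.  So it is the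
  projection onto \<open>M\<close>, which is the closure of the range of \<open>Y\<^sup>*\<close>.
\<close>

lemma polar_decomposition_if_factors:
  assumes W: "adjoint_pair W W'" and Y: "adjoint_pair Y Y'" and pf: "polar_factors Y W W' N"
  shows "polar_decomposition ip Y W"
proof -
  have N: "norm_positive N" and YWN: "Y x = W (N x)" and WYN: "W' (Y x) = N x"
    and into: "W' (W x) \<in> closure (range N)" for x
    by (fact polar_factorsD[OF pf])+
  note W' = adjoint_pair_sym[OF W]
  note mod = modulus_adjoint[OF W Y norm_positive_selfadjoint[OF N] YWN WYN]
  have absY: "op_abs ip Y = N" by (rule op_abs_eqI[OF Y N mod(4)])
  define M where "M = closure (range N)"
  have fixM: "W' (W z) = z" if "z \<in> M" for z
    using polar_factors_fixed[OF W pf] that by (simp add: M_def)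
  have intoM: "W' (W x) \<in> M" for x using into by (simp add: M_def)
  have WW: "adjoint_pair (\<lambda>x. W' (W x)) (\<lambda>x. W' (W x))" by (rule adjoint_pair_comp[OF W' W])
  have perp: "x - W' (W x) \<in> orth_compl ip M" for x
    by (simp add: orth_compl_def ip_diff_left adjoint_pairD[OF WW] fixM)
  have oc: "orthogonally_complemented ip M"
    unfolding orthogonally_complemented_def
  proof (intro conjI allI)
    show "\<exists>m\<in>M. \<exists>n\<in>orth_compl ip M. x = m + n" for x
      using intoM[of x] perp[of x] by (intro bexI[of _ "W' (W x)"] bexI[of _ "x - W' (W x)"]) simp_all
    have "0 \<in> M"
      using intoM[of 0] by (simp add: adjoint_pair_zero_arg[OF WW])
    then show "M \<inter> orth_compl ip M = {0}"
      by (auto simp: orth_compl_def intro: ip_self_eq_0)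
  qed
  have "adj ip W \<circ> W = proj_onto ip M"
    using proj_onto_eqI[OF intoM perp] by (simp add: adj_eq[OF W] fun_eq_iff)
  moreover have "op_projection ip (adj ip W \<circ> W)"
    unfolding op_projection_def adj_eq[OF W] o_def
    using WW adj_eq[OF WW] fixM[OF intoM] by (auto simp: adjointable_iff)
  ultimately show ?thesis
    using oc W Y YWN
    by (auto simp: polar_decomposition_def partial_isometry_def adjointable_iff adj_eq[OF Y] mod(3)
        absY M_def fun_eq_iff)
qed

text \<open>
  The main point is \<open>W\<^sup>* W |Y| = |Y|\<close>.  The complement of the range of \<open>Y\<^sup>*\<close> is annihilated by \<open>Y\<^sup>* Y = |Y|\<^sup>2\<close>, hence by \<open>|Y|\<close>, so
  that \<open>|Y| W\<^sup>* W = |Y|\<close>; take adjoints.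
\<close>

lemma factors_if_polar_decomposition:
  assumes W: "adjoint_pair W W'" and Y: "adjoint_pair Y Y'" and pd: "polar_decomposition ip Y W"
  shows "polar_factors Y W W' (op_abs ip Y)"
proof -
  define N where "N = op_abs ip Y"
  have N: "norm_positive N" "N (N x) = Y' (Y x)" for x using op_abs[OF Y] by (auto simp: N_def)
  note Ns = norm_positive_selfadjoint[OF N(1)]
  note W' = adjoint_pair_sym[OF W]
  have WW: "adjoint_pair (\<lambda>x. W' (W x)) (\<lambda>x. W' (W x))" by (rule adjoint_pair_comp[OF W' W])
  define M where "M = closure (range Y')"
  have oc: "orthogonally_complemented ip M" and pr: "\<And>x. W' (W x) = proj_onto ip M x"
    and YWN: "\<And>x. Y x = W (N x)"
    using pd by (auto simp: polar_decomposition_def adj_eq[OF W] adj_eq[OF Y] M_def N_def fun_eq_iff)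
  have p: "W' (W x) \<in> M" "x - W' (W x) \<in> orth_compl ip M" for x
  proof -
    obtain m n where mn: "m \<in> M" "n \<in> orth_compl ip M" "x = m + n"
      using oc unfolding orthogonally_complemented_def by metis
    then have "W' (W x) = m" unfolding pr by (intro proj_onto_eqI) auto
    then show "W' (W x) \<in> M" "x - W' (W x) \<in> orth_compl ip M" using mn by auto
  qed
  have NWW: "N (W' (W x)) = N x" for x
  proof -
    let ?u = "x - W' (W x)"
    have "Y' (Y ?u) \<in> M" using closure_subset[of "range Y'"] by (auto simp: M_def)
    then have "ip (N ?u) (N ?u) = 0"
      using p(2)[of x] by (simp add: adjoint_pairD[OF Ns] N(2) orth_compl_def)
    then have "N ?u = 0" by (rule ip_self_eq_0)
    then show ?thesis by (simp add: adjoint_pair_arg[OF Ns])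
  qed
  have WYN: "W' (Y x) = N x" for x
    using selfadjoint_commute_adjoint[OF Ns WW NWW] by (simp add: YWN)
  have "range Y' = range N" by (rule modulus_adjoint(3)[OF W Y Ns YWN WYN])
  then show ?thesis
    using N(1) YWN WYN p(1) by (simp add: polar_factors_def M_def flip: N_def)
qed

lemma norm_positive_conjugate:
  assumes N: "norm_positive N" and F: "adjoint_pair F F'"
  shows "norm_positive (\<lambda>x. F' (N (F x)))"
proof -
  obtain R where R: "norm_positive R" "\<And>x. R (R x) = N x" using norm_positive_root[OF N] by metis
  show ?thesis
    using norm_positive_adjoint_comp[OF adjoint_pair_comp[OF norm_positive_selfadjoint[OF R(1)] F]]
    by (simp add: R(2))
qed

text \<open>
  The positive factor of \<open>E Y F\<close> is \<open>F\<^sup>* N F\<close>, where \<open>N\<close> is that of \<open>Y\<close>.  The hypotheses say that \<open>F F\<^sup>*\<close> and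
  \<open>E\<^sup>* E\<close> act as identities wherever they occur in the products.
\<close>

lemma polar_decomposition_transfer:
  assumes E: "adjoint_pair E E'" and F: "adjoint_pair F F'"
    and Y: "adjoint_pair Y Y'" and W: "adjoint_pair W W'"
    and YFF: "\<And>x. Y (F (F' x)) = Y x" and EEY: "\<And>x. E' (E (Y x)) = Y x"
    and EEW: "\<And>x. E' (E (W x)) = W x"
    and pd: "polar_decomposition ip Y W"
  shows "polar_decomposition ip (\<lambda>x. E (Y (F x))) (\<lambda>x. E (W (F x)))"
proof -
  define N where "N = op_abs ip Y"
  have pf: "polar_factors Y W W' N"
    unfolding N_def by (rule factors_if_polar_decomposition[OF W Y pd])
  have N: "norm_positive N" and YWN: "Y x = W (N x)" and WYN: "W' (Y x) = N x"
    and into: "W' (W x) \<in> closure (range N)" for x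
    by (fact polar_factorsD[OF pf])+
  note F' = adjoint_pair_sym[OF F]
  have NFF: "N (F (F' x)) = N x" for x by (simp add: YFF flip: WYN)
  have FFN: "F (F' (N x)) = N x" for x
    by (rule selfadjoint_commute_adjoint[OF norm_positive_selfadjoint[OF N] adjoint_pair_comp[OF F F'] NFF])
  let ?N = "\<lambda>x. F' (N (F x))"
  have "F' (W' (W (F x))) \<in> closure (range ?N)" for x
  proof -
    have "F' (N z) \<in> range ?N" for z
      by (rule range_eqI[of _ _ "F' z"]) (simp add: NFF)
    then have "F' ` range N \<subseteq> range ?N" by blast
    from subsetD[OF closure_mono[OF this] adjoint_pair_image_closure[OF F' into]] show ?thesis .
  qed
  then have "polar_factors (\<lambda>x. E (Y (F x))) (\<lambda>x. E (W (F x))) (\<lambda>x. F' (W' (E' x))) ?N"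
    using norm_positive_conjugate[OF N F]
    by (simp add: polar_factors_def FFN YWN[symmetric] EEY WYN EEW)
  then show ?thesis
    by (rule polar_decomposition_if_factors[rotated 2])
      (rule adjoint_pair_comp[OF E adjoint_pair_comp[OF W F]] adjoint_pair_comp[OF E adjoint_pair_comp[OF Y F]])+
qed

lemma contraction_adjoint:
  assumes B: "adjoint_pair B B'" and le: "\<And>x. norm (B x) \<le> norm x"
  shows "norm (B' x) \<le> norm x"
proof (cases "B' x = 0")
  case False
  have "(norm (B' x))\<^sup>2 = norm (ip x (B (B' x)))"
    by (simp add: power2_norm_ip adjoint_pairD[OF adjoint_pair_sym[OF B]])
  also have "\<dots> \<le> norm x * norm (B' x)"
    using cauchy_schwarz[of x "B (B' x)"] mult_left_mono[OF le[of "B' x"], of "norm x"] by simp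
  finally show ?thesis using False by (simp add: power2_eq_square)
qed simp

text \<open>
  With a root \<open>Z\<close> of the positive operator \<open>1 - C\<^sup>* C\<close>, the equation of inner products turns into
  \<open>\<langle>(1 - Q) C v, (1 - Q) C v\<rangle> + \<langle>Z v, Z v\<rangle> = 0\<close>, so both summands vanish.
\<close>

lemma contraction_isometric_vector:
  assumes C: "adjoint_pair C C'" and le: "\<And>x. norm (C x) \<le> norm x"
    and Q: "adjoint_pair Q Q" "\<And>x. Q (Q x) = Q x"
    and eq: "ip (Q (C v)) (Q (C v)) = ip v v"
  shows "Q (C v) = C v" "C' (C v) = v"
proof -
  note C' = adjoint_pair_sym[OF C]
  have "norm_positive (\<lambda>x. 1 *\<^sub>R x - C' (C x))"
  proof (rule norm_positive_bound_minus[OF adjoint_pair_comp[OF C' C]])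
    show "norm (C' (C x)) \<le> 1 * norm x" for x
      using contraction_adjoint[OF C le, of "C x"] le[of x] by simp
  qed simp
  then obtain Z where Z: "norm_positive Z" "\<And>x. Z (Z x) = x - C' (C x)"
    by (rule norm_positive_root) auto
  note Zs = norm_positive_selfadjoint[OF Z(1)]
  have zz: "ip (Z v) (Z v) = ip v v - ip (C v) (C v)"
    by (simp add: adjoint_pairD[OF Zs] Z(2) ip_linear adjoint_pairD[OF C])
  have "ip (C v - Q (C v)) (C v - Q (C v)) = ip (C v) (C v) - ip (Q (C v)) (Q (C v))"
    by (simp add: ip_linear adjoint_pairD[OF Q(1)] Q(2))
  then have sum0: "ip (C v - Q (C v)) (C v - Q (C v)) + ip (Z v) (Z v) = 0"
    by (simp add: zz eq)
  show "Q (C v) = C v" using ip_add_eq_0D[OF sum0] by simp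
  have "Z v = 0" using ip_add_eq_0D[of "Z v" "C v - Q (C v)"] sum0 by (simp add: add.commute)
  then show "C' (C v) = v" using Z(2)[of v] adjoint_pair_zero_arg[OF Zs] by simp
qed

text \<open>
  The positive factor must be \<open>B\<^sup>* Y\<close>.  Given the polar decomposition with \<open>N = |Y| = Q B\<^sup>* Y\<close>, the
  contraction \<open>B\<^sup>*\<close> satisfies \<open>\<langle>Q B\<^sup>* y, Q B\<^sup>* y\<rangle> = \<langle>y, y\<rangle>\<close> for \<open>y\<close> in the range of \<open>Y\<close>, so that the
  compression by \<open>Q\<close> loses nothing.  The ranges agree because \<open>W = W W\<^sup>* W\<close> and \<open>W\<^sup>* W\<close> maps into the
  closed range of \<open>N\<close>.
\<close>

lemma polar_decomposition_compression_iff: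
  assumes B: "adjoint_pair B B'" and le: "\<And>x. norm (B x) \<le> norm x"
    and P: "adjoint_pair P P" "\<And>x. P (P x) = P x" and Q: "adjoint_pair Q Q" "\<And>x. Q (Q x) = Q x"
    and Y: "adjoint_pair Y Y'" and PY: "\<And>x. P (Y x) = Y x" and YQ: "\<And>x. Y (Q x) = Y x"
  defines "W \<equiv> \<lambda>x. P (B (Q x))" and "W' \<equiv> \<lambda>x. Q (B' (P x))"
  shows "polar_decomposition ip Y W \<longleftrightarrow>
      norm_positive (\<lambda>x. B' (Y x)) \<and> (\<forall>x. B (B' (Y x)) = Y x) \<and>
      closure (range W) = closure (range Y)" (is "?pd \<longleftrightarrow> ?iii")
    and "polar_decomposition ip Y W \<longleftrightarrow>
      norm_positive (\<lambda>x. B' (Y x)) \<and> (\<forall>x. B (B' (Y x)) = Y x) \<and>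
      closure (range W') = closure (range Y')" (is "?pd \<longleftrightarrow> ?iv")
proof -
  note B' = adjoint_pair_sym[OF B]
  have W: "adjoint_pair W W'"
    unfolding W_def W'_def by (rule adjoint_pair_comp[OF P(1) adjoint_pair_comp[OF B Q(1)]])
  note W' = adjoint_pair_sym[OF W]
  have fwd: "?iii \<and> ?iv" if pd: ?pd
  proof -
    define N where "N = op_abs ip Y"
    have pf: "polar_factors Y W W' N"
      unfolding N_def by (rule factors_if_polar_decomposition[OF W Y pd])
    have N: "norm_positive N" and YWN: "Y x = W (N x)" and WYN: "W' (Y x) = N x"
      and into: "W' (W x) \<in> closure (range N)" for x
      by (fact polar_factorsD[OF pf])+
    note Ns = norm_positive_selfadjoint[OF N]
    note mod = modulus_adjoint[OF W Y Ns YWN WYN]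
    note pi = polar_factors_partial_isometry[OF W pf]
    have NQ: "N x = Q (B' (Y x))" for x by (simp add: W'_def PY flip: WYN)
    have "ip (Q (B' (Y x))) (Q (B' (Y x))) = ip (Y x) (Y x)" for x
      by (simp add: NQ[symmetric] adjoint_pairD[OF Ns] adjoint_pairD[OF Y] mod(4))
    note iso = contraction_isometric_vector[OF B' contraction_adjoint[OF B le] Q this]
    have BYN: "B' (Y x) = N x" for x by (simp add: iso(1) NQ)
    have "range W \<subseteq> closure (range Y)"
    proof
      fix y assume "y \<in> range W"
      then obtain x where "y = W (W' (W x))" using pi(1) by auto
      moreover have "W ` range N = range Y" by (auto simp: YWN)
      ultimately show "y \<in> closure (range Y)" using adjoint_pair_image_closure[OF W into] by metis
    qed
    moreover have "range Y \<subseteq> range W" by (auto simp: YWN)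
    ultimately have "closure (range W) = closure (range Y)"
      by (simp add: closure_minimal closure_mono subset_antisym)
    moreover have "closure (range W') = closure (range Y')"
    proof -
      have "range W' \<subseteq> closure (range Y')" using into pi(2) mod(3) by (metis image_subsetI)
      moreover have "range Y' \<subseteq> range W'" unfolding mod(3) by (metis WYN image_subsetI rangeI)
      ultimately show ?thesis by (simp add: closure_minimal closure_mono subset_antisym)
    qed
    ultimately show ?thesis using N iso(2) by (simp add: BYN)
  qed
  have bwd: ?pd if np: "norm_positive (\<lambda>x. B' (Y x))" and BBY: "\<forall>x. B (B' (Y x)) = Y x"
    and cl: "closure (range W) = closure (range Y) \<or> closure (range W') = closure (range Y')"
  proof -
    define N where "N x = B' (Y x)" for x
    have N: "norm_positive N" using np by (simp add: N_def[abs_def])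
    note Ns = norm_positive_selfadjoint[OF N]
    have QN: "Q (N x) = N x" for x
      by (rule selfadjoint_commute_adjoint[OF Ns Q(1)]) (simp add: N_def YQ)
    have YWN: "Y x = W (N x)" for x by (simp add: W_def QN) (simp add: N_def BBY PY)
    have WYN: "W' (Y x) = N x" for x using QN[of x] by (simp add: W'_def PY N_def)
    have "W' (W x) \<in> closure (range N)" for x
      using cl
    proof
      assume "closure (range W) = closure (range Y)"
      then have "W x \<in> closure (range Y)" using closure_subset[of "range W"] by auto
      moreover have "W' ` range Y = range N" by (simp add: image_image WYN)
      ultimately show ?thesis
        using adjoint_pair_image_closure[OF W', of "W x" "range Y"] by simp
    next
      assume "closure (range W') = closure (range Y')"
      then have "W' (W x) \<in> closure (range Y')" using closure_subset[of "range W'"] by auto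
      then show ?thesis using modulus_adjoint(3)[OF W Y Ns YWN WYN] by simp
    qed
    then have "polar_factors Y W W' N" using N YWN WYN by (simp add: polar_factors_def)
    then show ?pd by (rule polar_decomposition_if_factors[OF W Y])
  qed
  show "?pd \<longleftrightarrow> ?iii" "?pd \<longleftrightarrow> ?iv" using fwd bwd by blast+
qed

text \<open>
  \<open>|S\<^sup>*| = U |S| U\<^sup>*\<close>, since the right-hand side is positive with the square
  \<open>U |S| U\<^sup>* U |S| U\<^sup>* = U |S|\<^sup>2 U\<^sup>* = S S\<^sup>*\<close>.
\<close>

lemma op_abs_adjoint:
  assumes S: "adjoint_pair S S'" and U: "adjoint_pair U U'" and pd: "polar_decomposition ip S U"
  shows "op_abs ip S' x = U (op_abs ip S (U' x))"
proof -
  define N where "N = op_abs ip S"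
  have pf: "polar_factors S U U' N"
    unfolding N_def by (rule factors_if_polar_decomposition[OF U S pd])
  have N: "norm_positive N" and SUN: "S x = U (N x)" and USN: "U' (S x) = N x" for x
    by (fact polar_factorsD[OF pf])+
  note mod = modulus_adjoint[OF U S norm_positive_selfadjoint[OF N] SUN USN]
  have "op_abs ip S' = (\<lambda>x. U (N (U' x)))"
  proof (rule op_abs_eqI[OF adjoint_pair_sym[OF S]])
    show "norm_positive (\<lambda>x. U (N (U' x)))" by (rule norm_positive_conjugate[OF N adjoint_pair_sym[OF U]])
    show "U (N (U' (U (N (U' x))))) = S (S' x)" for x
      by (simp add: SUN[symmetric] USN mod(1))
  qed
  then show ?thesis by (simp add: N_def)
qed

end

section \<open>The Cauchy-Schwarz inequality in Hilbert modules\<close>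

context hilbert_module
begin

lemma cstar_valued_form: "cstar_valued_form ip"
  by unfold_locales (rule ip_add_right ip_scaleC_right ip_star norm_ip)+

lemma ip_act_left: "ip (act y a) x = star a * ip y x"
  using star_mult[of "ip x y" a] by (simp add: ip_star flip: ip_act_right)

lemma norm_act_le: "norm (act y a) \<le> norm y * norm a"
proof -
  interpret cstar_valued_form ip by (rule cstar_valued_form)
  have "(norm (act y a))\<^sup>2 = norm (star a * (ip y y * a))"
    by (simp add: power2_norm_ip ip_act_left ip_act_right mult.assoc)
  also have "\<dots> \<le> norm (star a) * norm (ip y y * a)" by (rule norm_mult_ineq)
  also have "\<dots> \<le> norm a * (norm (ip y y) * norm a)"
    by (simp add: norm_star norm_mult_ineq mult_left_mono)
  also have "\<dots> = (norm y * norm a)\<^sup>2" by (simp add: power2_norm_ip[symmetric] power2_eq_square)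
  finally show ?thesis by (rule power2_le_imp_le) simp
qed

text \<open>
  Let \<open>c = \<langle>y, x\<rangle>\<close> and \<open>v = y c\<close>.  By polarization, \<open>4 t c\<^sup>* c\<close> is the difference of the positive elements
  \<open>\<langle>x \<plusminus> t v, x \<plusminus> t v\<rangle>\<close>, whose norms are at most \<open>(\<parallel>x\<parallel> + t \<parallel>y\<parallel> \<parallel>c\<parallel>)\<^sup>2\<close>; so this also bounds \<open>4 t \<parallel>c\<parallel>\<^sup>2\<close>.
  The best choice of \<open>t\<close> makes the two summands equal.
\<close>

lemma hilbert_module_cauchy_schwarz: "norm (ip x y) \<le> norm x * norm y"
proof -
  interpret cstar_valued_form ip by (rule cstar_valued_form)
  define c where "c = ip y x"
  define v where "v = act y c"
  have cnorm: "norm (ip x y) = norm c" using norm_star[of c] by (simp add: c_def ip_star)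
  show ?thesis
  proof (cases "c = 0 \<or> y = 0")
    case True
    then show ?thesis using cnorm by (auto simp: c_def)
  next
    case False
    define t where "t = norm x / (norm y * norm c)"
    have t: "t \<ge> 0" by (simp add: t_def)
    have tn: "t * (norm y * norm c) = norm x" using False by (simp add: t_def)
    have tv: "norm (t *\<^sub>R v) \<le> norm x"
      using norm_act_le[of y c] t mult_left_mono[OF _ t] tn by (simp add: v_def) metis
    have "ip x v = star c * c" "ip v x = star c * c"
      by (simp_all add: v_def ip_act_left ip_act_right c_def ip_star)
    then have "ip (x + t *\<^sub>R v) (x + t *\<^sub>R v) - ip (x - t *\<^sub>R v) (x - t *\<^sub>R v) = (4 * t) *\<^sub>R (star c * c)"
      by (simp add: ip_linear algebra_simps flip: scaleR_add_left)
    moreover have "norm (ip (x + t *\<^sub>R v) (x + t *\<^sub>R v) - ip (x - t *\<^sub>R v) (x - t *\<^sub>R v)) \<le> (2 * norm x)\<^sup>2"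
    proof (rule norm_diff_le_of_cstar_positive[OF ip_positive ip_positive]; unfold power2_norm_ip[symmetric])
      show "(norm (x + t *\<^sub>R v))\<^sup>2 \<le> (2 * norm x)\<^sup>2"
        using norm_triangle_ineq[of x "t *\<^sub>R v"] tv by (intro power_mono) auto
      show "(norm (x - t *\<^sub>R v))\<^sup>2 \<le> (2 * norm x)\<^sup>2"
        using norm_triangle_ineq4[of x "t *\<^sub>R v"] tv by (intro power_mono) auto
    qed
    ultimately have "4 * t * (norm c)\<^sup>2 \<le> 4 * (norm x)\<^sup>2"
      using t by (simp add: cstar_identity power_mult_distrib)
    then have "norm x * norm c \<le> norm x * (norm x * norm y)"
      using False by (simp add: t_def power2_eq_square field_simps)
    then show ?thesis using cnorm by (cases "x = 0") auto
  qed
qed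

lemma cstar_module_ip: "cstar_module_ip ip"
proof -
  interpret cstar_valued_form ip by (rule cstar_valued_form)
  show ?thesis
    by unfold_locales
      (auto intro: hilbert_module_cauchy_schwarz norm_le_norm_add_cstar_positive ip_positive)
qed

end

section \<open>Polar decompositions of products\<close>

theorem theorem4p4:
  fixes act :: "'h::complex_banach \<Rightarrow> 'a::cstar_algebra \<Rightarrow> 'h"
    and ip :: "'h \<Rightarrow> 'h \<Rightarrow> 'a"
    and T A S B UT US X Y W :: "'h \<Rightarrow> 'h"
  assumes "hilbert_module act ip"
    and "adjointable ip T" and "adjointable ip A" and "adjointable ip S" and "adjointable ip B"
    and "polar_decomposition ip T UT"
    and "polar_decomposition ip S US"
    and "onorm B \<le> 1"
    and "X = T \<circ> A \<circ> S"
    and "Y = op_abs ip T \<circ> A \<circ> op_abs ip (adj ip S)"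
    and "W = adj ip UT \<circ> UT \<circ> B \<circ> US \<circ> adj ip US"
  shows "(polar_decomposition ip X (UT \<circ> B \<circ> US) \<longleftrightarrow> polar_decomposition ip Y W) \<and>
         (polar_decomposition ip Y W \<longleftrightarrow>
            op_positive ip (adj ip B \<circ> Y) \<and> B \<circ> adj ip B \<circ> Y = Y \<and>
            closure (range W) = closure (range Y)) \<and>
         (polar_decomposition ip Y W \<longleftrightarrow>
            op_positive ip (adj ip B \<circ> Y) \<and> B \<circ> adj ip B \<circ> Y = Y \<and>
            closure (range (adj ip W)) = closure (range (adj ip Y)))"
proof -
  interpret cstar_module_ip ip by (rule hilbert_module.cstar_module_ip[OF assms(1)])
  define UT' where "UT' = adj ip UT"
  define US' where "US' = adj ip US"
  define B' where "B' = adj ip B"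
  have T: "adjoint_pair T (adj ip T)" and A: "adjoint_pair A (adj ip A)"
    and S: "adjoint_pair S (adj ip S)" and B: "adjoint_pair B B'"
    and UT: "adjoint_pair UT UT'" and US: "adjoint_pair US US'"
    using assms(2-7) by (auto simp: adjoint_pair_adj UT'_def US'_def B'_def
        polar_decomposition_def partial_isometry_def)
  note UT' = adjoint_pair_sym[OF UT] and US' = adjoint_pair_sym[OF US]
  have "norm (B x) \<le> norm x" for x
    using onorm[OF adjoint_pair_bounded_linear[OF B], of x] mult_right_mono[OF assms(8), of "norm x"]
    by simp
  note contr = this
  define NT where "NT = op_abs ip T"
  define NS where "NS = op_abs ip S"
  have pfT: "polar_factors T UT UT' NT"
    unfolding NT_def by (rule factors_if_polar_decomposition[OF UT T assms(6)])
  have pfS: "polar_factors S US US' NS"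
    unfolding NS_def by (rule factors_if_polar_decomposition[OF US S assms(7)])
  have TN: "T x = UT (NT x)" "UT' (T x) = NT x" and SN: "S x = US (NS x)" "US' (S x) = NS x" for x
    by (fact polar_factorsD[OF pfT] polar_factorsD[OF pfS])+
  have NTs: "adjoint_pair NT NT" and NSs: "adjoint_pair NS NS"
    by (intro norm_positive_selfadjoint polar_factorsD(1)[OF pfT] polar_factorsD(1)[OF pfS])+
  note piT = polar_factors_partial_isometry[OF UT pfT]
    and piS = polar_factors_partial_isometry[OF US pfS]
  define NS' where "NS' = op_abs ip (adj ip S)"
  have NS': "NS' x = US (NS (US' x))" for x
    unfolding NS'_def NS_def by (rule op_abs_adjoint[OF S US assms(7)])
  have NS's: "adjoint_pair NS' NS'"
    unfolding NS'_def by (rule norm_positive_selfadjoint[OF op_abs(1)[OF adjoint_pair_sym[OF S]]])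
  have NSU: "US' (US (NS x)) = NS x" for x by (simp add: SN(2) flip: SN(1))
  have NSU': "NS (US' (US x)) = NS x" for x
  proof -
    have "adjoint_pair NS (\<lambda>x. NS (US' (US x)))"
      using adjoint_pair_comp[OF adjoint_pair_comp[OF US' US] NSs] by (simp add: NSU)
    from adjoint_pair_unique[OF NSs this] show ?thesis by (rule fun_cong[symmetric])
  qed
  define P where "P x = UT' (UT x)" for x
  define Q where "Q x = US (US' x)" for x
  have P: "adjoint_pair P P" "P (P x) = P x" for x
    using adjoint_pair_comp[OF UT' UT] by (simp_all add: P_def[abs_def] piT)
  have Q: "adjoint_pair Q Q" "Q (Q x) = Q x" for x
    using adjoint_pair_comp[OF US US'] by (simp_all add: Q_def[abs_def] piS)
  have Y: "Y = (\<lambda>x. NT (A (NS' x)))" using assms(10) by (auto simp: NT_def NS'_def)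
  have W: "W = (\<lambda>x. P (B (Q x)))" using assms(11) by (auto simp: P_def Q_def UT'_def US'_def)
  have X: "X = (\<lambda>x. UT (Y (US x)))" using assms(9) by (auto simp: Y TN SN NS' NSU')
  define V where "V x = UT (B (US x))" for x
  have Vo: "UT \<circ> B \<circ> US = V" by (auto simp: V_def)
  have Ypair: "adjoint_pair Y (\<lambda>x. NS' (adj ip A (NT x)))"
    unfolding Y by (rule adjoint_pair_comp[OF NTs adjoint_pair_comp[OF A NS's]])
  have Wpair: "adjoint_pair W (\<lambda>x. Q (B' (P x)))"
    unfolding W by (rule adjoint_pair_comp[OF P(1) adjoint_pair_comp[OF B Q(1)]])
  have Xpair: "adjoint_pair X (\<lambda>x. US' (NS' (adj ip A (NT (UT' x)))))"
    unfolding X by (rule adjoint_pair_comp[OF UT adjoint_pair_comp[OF Ypair US]])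
  have Vpair: "adjoint_pair V (\<lambda>x. US' (B' (UT' x)))"
    unfolding V_def[abs_def] by (rule adjoint_pair_comp[OF UT adjoint_pair_comp[OF B US]])
  have PY: "P (Y x) = Y x" and YQ: "Y (Q x) = Y x" for x
    by (simp_all add: P_def Q_def Y TN(1)[symmetric] TN(2) NS' piS)
  have VW: "V = (\<lambda>x. UT (W (US x)))" by (auto simp: V_def W P_def Q_def piT piS)
  have YX: "Y = (\<lambda>x. UT' (X (US' x)))" using PY YQ by (simp add: X P_def Q_def)
  have WV: "W = (\<lambda>x. UT' (V (US' x)))" by (auto simp: V_def W P_def Q_def)
  have "polar_decomposition ip X V \<longleftrightarrow> polar_decomposition ip Y W"
  proof
    assume "polar_decomposition ip Y W"
    then show "polar_decomposition ip X V"
      unfolding X VW using YQ PY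
      by (intro polar_decomposition_transfer[OF UT US Ypair Wpair]) (simp_all add: P_def Q_def W piT)
  next
    assume "polar_decomposition ip X V"
    \<comment> \<open>The relations between \<open>X\<close>, \<open>V\<close> and \<open>Y\<close>, \<open>W\<close> are symmetric under \<open>U\<^sub>T \<leftrightarrow> U\<^sub>T\<^sup>*\<close> and \<open>U\<^sub>S \<leftrightarrow> U\<^sub>S\<^sup>*\<close>.\<close>
    then have "polar_decomposition ip (\<lambda>x. UT' (X (US' x))) (\<lambda>x. UT' (V (US' x)))"
      by (intro polar_decomposition_transfer[OF UT' US' Xpair Vpair]) (simp_all add: X V_def piT piS)
    then show "polar_decomposition ip Y W" by (simp only: YX[symmetric] WV[symmetric])
  qed
  moreover have "B \<circ> B' \<circ> Y = Y \<longleftrightarrow> (\<forall>x. B (B' (Y x)) = Y x)" by (auto simp: fun_eq_iff)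
  moreover have "op_positive ip (B' \<circ> Y) \<longleftrightarrow> norm_positive (\<lambda>x. B' (Y x))"
    by (simp add: op_positive_iff o_def)
  ultimately show ?thesis
    using polar_decomposition_compression_iff[OF B contr P Q Ypair PY YQ, folded W]
    unfolding Vo adj_eq[OF Wpair] adj_eq[OF Ypair] B'_def[symmetric] by simp
qed

end
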